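(* Let $f$ be a twist map of the annulus, let $c\in\mathbb{R}$, and let $u_c:\mathbb{R}\to\mathbb{R}$ be a discrete weak K.A.M. solution for $f$ at cohomology class $c$. Then the optimal forward map $$\Sigma_+:\mathbb{R}\to\mathbb{R},\qquad x\mapsto \mathop{\mathrm{arg\,max}}_{y\in\mathbb{R}}\{u_c(y)-S_c(x,y)\}$$ is single-valued (for every $x$ the set of maximizers is a singleton). Moreover, $\Sigma_+$ satisfies the following properties: (i) $\Sigma_+$ is a lift of a circle map of degree $1$, i.e. $\Sigma_+(x+1)=\Sigma_+(x)+1$; (ii) $\Sigma_+$ is non-decreasing and Lipschitz continuous; (iii) $\Sigma_+$ propagates singularities of $u_c$: if $u_c$ is not differentiable at $x$, then $u_c$ is not differentiable at $\Sigma_+(x)$; (iv) $\Sigma_+$ admits a rotation number for positive iterations, that is, the limit $\rho(\Sigma_+):=\lim_{n\to+\infty}\frac1n(\Sigma_+^n(x)-x)$ exists for all $x\in\mathbb{R}$ and is independent of $x$; in fact $\rho(\Sigma_+)=\alpha'(c)$.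
   Context: Let $\mathbb{T}=\mathbb{R}/\mathbb{Z}$. A twist map of the annulus is a $C^1$-diffeomorphism $f:\mathbb{T}\times\mathbb{R}\to\mathbb{T}\times\mathbb{R}$ such that: (1) $f$ is isotopic to the identity; (2) $f$ is exact symplectic, i.e. if $f(\theta,p)=(\theta',p')$ then the $1$-form $p'd\theta'-p\,d\theta$ is exact; (3) if $F:\mathbb{R}^2\to\mathbb{R}^2$, $F(x,p)=(y,p')$, is a lift of $f$, there is $\varepsilon>0$ with $0<\frac{\partial y}{\partial p}(x,p)<\frac1\varepsilon$ for all $(x,p)$. Fix a lift $F$ of $f$. Its generating function is a $C^2$ function $S:\mathbb{R}^2\to\mathbb{R}$ (which exists and is unique up to an additive constant) such that $S(x+1,y+1)=S(x,y)$; there is $\varepsilon>0$ with $\frac{\partial^2S}{\partial x\partial y}<-\varepsilon$ everywhere; and $F(x,p)=(y,p')$ if and only if $p=-\partial_1S(x,y)$ and $p'=\partial_2S(x,y)$. Here $\partial_1,\partial_2$ are the partial derivatives in the first and second variable. For $c\in\mathbb{R}$ put $S_c(x,y)=S(x,y)+c(x-y)$. For a bounded $1$-periodic function $u:\mathbb{R}\to\mathbb{R}$ put $T^-[u](x)=\inf_{y\in\mathbb{R}}\{u(y)+S_c(y,x)\}$. There is a unique constant $\overline{S}_c\in\mathbb{R}$ for which the equation $u=T^-[u]-\overline{S}_c$ has a continuous $1$-periodic solution $u$; any such solution is called a discrete weak K.A.M. solution for $f$ at cohomology class $c$. Mather's function is $\alpha(c)=-\overline{S}_c$; it is differentiable at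 every $c\in\mathbb{R}$. *)

theory Defs
  imports "HOL-Analysis.Analysis"
begin

subsection \<open>The annulus\<close>

text \<open>The circle is the type \<open>\<real>/\<int>\<close>; the projection from the reals is \<open>abs_circle\<close>.\<close>

quotient_type circle = real / "\<lambda>x y. x - y \<in> \<int>"
proof (rule equivpI)
  show "reflp (\<lambda>x y::real. x - y \<in> \<int>)"
    by (simp add: reflp_def)
  show "symp (\<lambda>x y::real. x - y \<in> \<int>)"
    unfolding symp_def by (metis Ints_minus minus_diff_eq)
  show "transp (\<lambda>x y::real. x - y \<in> \<int>)"
  proof (rule transpI)
    fix x y z :: real
    assume "x - y \<in> \<int>" "y - z \<in> \<int>"
    then have "(x - y) + (y - z) \<in> \<int>" by (rule Ints_add)
    then show "x - z \<in> \<int>" by simp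
  qed
qed

instantiation circle :: topological_space
begin

text \<open>Quotient topology.\<close>

definition open_circle :: "circle set \<Rightarrow> bool" where
  "open_circle U \<longleftrightarrow> open (abs_circle -` U)"

instance
  by standard (auto simp: open_circle_def vimage_Union)

end

type_synonym annulus = "circle \<times> real"

definition proj :: "real \<times> real \<Rightarrow> annulus" where
  "proj = map_prod abs_circle id"

definition is_lift :: "(annulus \<Rightarrow> annulus) \<Rightarrow> (real \<times> real \<Rightarrow> real \<times> real) \<Rightarrow> bool" where
  "is_lift f F \<longleftrightarrow> continuous_on UNIV F \<and> proj \<circ> F = f \<circ> proj"

subsection \<open>Differentiability classes and partial derivatives\<close>

definition C1 :: "('a::real_normed_vector \<Rightarrow> 'b::real_normed_vector) \<Rightarrow> bool" where
  "C1 G \<longleftrightarrow> (\<exists>D :: 'a \<Rightarrow> 'a \<Rightarrow>\<^sub>L 'b.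
     (\<forall>z. (G has_derivative blinfun_apply (D z)) (at z)) \<and> continuous_on UNIV D)"

definition C2 :: "('a::real_normed_vector \<Rightarrow> 'b::real_normed_vector) \<Rightarrow> bool" where
  "C2 G \<longleftrightarrow> (\<exists>D :: 'a \<Rightarrow> 'a \<Rightarrow>\<^sub>L 'b.
     (\<forall>z. (G has_derivative blinfun_apply (D z)) (at z)) \<and> C1 D)"

definition partial1 :: "(real \<times> real \<Rightarrow> real) \<Rightarrow> real \<times> real \<Rightarrow> real" where
  "partial1 G z = deriv (\<lambda>t. G (t, snd z)) (fst z)"

definition partial2 :: "(real \<times> real \<Rightarrow> real) \<Rightarrow> real \<times> real \<Rightarrow> real" where
  "partial2 G z = deriv (\<lambda>t. G (fst z, t)) (snd z)"

text \<open>The projection is a local diffeomorphism from the plane, which is simply connected; hence a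
  map of the annulus is \<open>C\<^sup>1\<close> iff it has a \<open>C\<^sup>1\<close> lift.\<close>

definition C1_annulus :: "(annulus \<Rightarrow> annulus) \<Rightarrow> bool" where
  "C1_annulus f \<longleftrightarrow> (\<exists>F. is_lift f F \<and> C1 F)"

definition C1_diffeo :: "(annulus \<Rightarrow> annulus) \<Rightarrow> bool" where
  "C1_diffeo f \<longleftrightarrow> bij f \<and> C1_annulus f \<and> C1_annulus (inv f)"

subsection \<open>Twist maps\<close>

definition isotopic_to_id :: "(annulus \<Rightarrow> annulus) \<Rightarrow> bool" where
  "isotopic_to_id f \<longleftrightarrow>
     homotopic_with (homeomorphic_map euclidean euclidean) euclidean euclidean id f"

text \<open>Exactness of \<open>p' d\<theta>' - p d\<theta>\<close>: it is the differential of a function \<open>g\<close> on the annulus. The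
  equation \<open>dg = p' d\<theta>' - p d\<theta>\<close> is written in the coordinates \<open>(x, p)\<close> of the universal cover,
  where \<open>\<theta>' = fst (F (x, p))\<close> and \<open>p' = snd (F (x, p))\<close>; it is the same for all lifts \<open>F\<close>.
  That \<open>g\<close> lives on the annulus and not just on the plane is what makes the form exact
  rather than merely closed.\<close>

definition exact_symplectic :: "(annulus \<Rightarrow> annulus) \<Rightarrow> bool" where
  "exact_symplectic f \<longleftrightarrow> (\<forall>F. is_lift f F \<longrightarrow> (\<exists>g :: annulus \<Rightarrow> real. \<forall>z.
     ((g \<circ> proj) has_derivative
        (\<lambda>v. snd (F z) * fst (frechet_derivative F (at z) v) - snd z * fst v)) (at z)))"

definition twist_condition :: "(annulus \<Rightarrow> annulus) \<Rightarrow> bool" where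
  "twist_condition f \<longleftrightarrow> (\<forall>F. is_lift f F \<longrightarrow>
     (\<exists>\<epsilon>>0. \<forall>z. 0 < partial2 (fst \<circ> F) z \<and> partial2 (fst \<circ> F) z < 1 / \<epsilon>))"

definition twist_map :: "(annulus \<Rightarrow> annulus) \<Rightarrow> bool" where
  "twist_map f \<longleftrightarrow>
     C1_diffeo f \<and> isotopic_to_id f \<and> exact_symplectic f \<and> twist_condition f"

definition generating_function ::
    "(real \<times> real \<Rightarrow> real \<times> real) \<Rightarrow> (real \<times> real \<Rightarrow> real) \<Rightarrow> bool" where
  "generating_function F S \<longleftrightarrow>
     C2 S \<and>
     (\<forall>x y. S (x + 1, y + 1) = S (x, y)) \<and>
     (\<exists>\<epsilon>>0. \<forall>z. partial1 (partial2 S) z < - \<epsilon>) \<and>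
     (\<forall>x p y p'. F (x, p) = (y, p') \<longleftrightarrow>
        p = - partial1 S (x, y) \<and> p' = partial2 S (x, y))"

subsection \<open>Discrete weak K.A.M. solutions and Mather's function\<close>

definition S_coh :: "(real \<times> real \<Rightarrow> real) \<Rightarrow> real \<Rightarrow> real \<times> real \<Rightarrow> real" where
  "S_coh S c = (\<lambda>(x, y). S (x, y) + c * (x - y))"

definition T_minus :: "(real \<times> real \<Rightarrow> real) \<Rightarrow> real \<Rightarrow> (real \<Rightarrow> real) \<Rightarrow> real \<Rightarrow> real" where
  "T_minus S c u x = (INF y. u y + S_coh S c (y, x))"

definition weak_KAM_eq :: "(real \<times> real \<Rightarrow> real) \<Rightarrow> real \<Rightarrow> real \<Rightarrow> (real \<Rightarrow> real) \<Rightarrow> bool" where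
  "weak_KAM_eq S c s u \<longleftrightarrow>
     continuous_on UNIV u \<and> (\<forall>x. u (x + 1) = u x) \<and> (\<forall>x. u x = T_minus S c u x - s)"

definition S_bar :: "(real \<times> real \<Rightarrow> real) \<Rightarrow> real \<Rightarrow> real" where
  "S_bar S c = (THE s. \<exists>u. weak_KAM_eq S c s u)"

definition weak_KAM_solution :: "(real \<times> real \<Rightarrow> real) \<Rightarrow> real \<Rightarrow> (real \<Rightarrow> real) \<Rightarrow> bool" where
  "weak_KAM_solution S c u \<longleftrightarrow> weak_KAM_eq S c (S_bar S c) u"

definition mather_alpha :: "(real \<times> real \<Rightarrow> real) \<Rightarrow> real \<Rightarrow> real" where
  "mather_alpha S c = - S_bar S c"

definition forward_maximizers ::
    "(real \<times> real \<Rightarrow> real) \<Rightarrow> real \<Rightarrow> (real \<Rightarrow> real) \<Rightarrow> real \<Rightarrow> real set" where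
  "forward_maximizers S c u x = {y. is_arg_max (\<lambda>y. u y - S_coh S c (x, y)) (\<lambda>_. True) y}"

end

theory Submission
  imports Defs "HOL-Complex_Analysis.Great_Picard"
begin

text \<open>
  Write \<open>s\<close> for the constant \<open>S_bar S c\<close> and call \<open>y\<close> a predecessor of \<open>x\<close> if
  \<open>u x + s = u y + S_coh S c (y, x)\<close>. The weak K.A.M. equation says that every point has a predecessor
  and that \<open>u x + s \<le> u y + S_coh S c (y, x)\<close> for all \<open>x\<close> and \<open>y\<close>; hence, if \<open>y\<close> is a predecessor of
  \<open>x\<close>, then \<open>x\<close> maximizes \<open>u - S_coh S c (y, \<cdot>)\<close>. The twist condition, integrated over a rectangle
  (\<open>twist_inequality\<close>), makes such maximizers non-decreasing functions of the base point. The whole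
  geometric part of the theorem comes from playing these two facts against each other.

  Suppose that \<open>y < y'\<close> are both maximizers at \<open>x\<close>. A point \<open>w\<close> strictly between them is a maximizer at
  its predecessor, so by monotonicity this predecessor can only be \<open>x\<close>. A point that has a predecessor
  \<open>v\<close> and is itself the predecessor of some \<open>w\<close> is a point of differentiability of \<open>u\<close>, because there
  \<open>u\<close> is squeezed between the smooth functions \<open>u w + s - S_coh S c (\<cdot>, w)\<close> and
  \<open>u v + S_coh S c (v, \<cdot>) - s\<close>; its derivative is \<open>- \<partial>\<^sub>1S(x, w) - c\<close>
  (\<open>calibrated_interior_derivative\<close>). This value would be the same for all \<open>w\<close> between \<open>y\<close> and \<open>y'\<close>,
  although \<open>\<partial>\<^sub>1S(x, \<cdot>)\<close> is strictly decreasing: a contradiction, and the optimal forward map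
  \<open>\<Sigma>\<close> is single-valued. The Lipschitz bound is the quantitative form of the same argument: \<open>u\<close> is
  semiconcave, so its derivative at points \<open>z\<close> grows at most linearly in \<open>z\<close>, while
  \<open>- \<partial>\<^sub>1S(z, w)\<close> grows at least linearly in \<open>w\<close>. Finally, if \<open>u\<close> is differentiable at
  \<open>\<Sigma> x\<close>, its derivative there determines the predecessor of \<open>\<Sigma> x\<close>, which must then be \<open>x\<close>, and so \<open>u\<close> is
  differentiable at \<open>x\<close> as well.

  A monotone map that commutes with the unit translation has a rotation number, because the
  displacements of its iterates are additive up to a bounded error. To compare it with \<open>\<alpha>\<close>, follow
  predecessors backwards from \<open>0\<close>: this is an orbit of \<open>\<Sigma>\<close> along which the action at \<open>c\<close> is computed exactly
  by \<open>u\<close>, and the same orbit gives an inequality for every solution at another class \<open>c'\<close>. Dividing by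
  the number of steps yields \<open>\<alpha>(c') \<ge> \<alpha>(c) + \<rho> (c' - c)\<close> (\<open>rotation_subgradient\<close>). A function with a
  subgradient that depends continuously on the point is differentiable, so it remains to see that
  \<open>\<rho>\<close> is a continuous function of \<open>c\<close>. By compactness a sequence of solutions at \<open>c\<^sub>n \<rightarrow> c\<close> has a
  subsequence converging to a solution at \<open>c\<close>, and the forward maps converge too; this suffices once
  the rotation number is known to be the same for all solutions at \<open>c\<close>. The reason for the latter
  (\<open>rotation_independent\<close>) is that the minimum of two solutions is again a solution. After adding a
  constant to one of them, it coincides with each of the two at a common point, hence along the
  backward orbits from that point, and so it shares the rotation number of both.

  Since \<open>S_bar\<close> is defined by a description, these comparisons also need that solutions exist
  at every \<open>c\<close>, for exactly one constant. They are limits of iterates of the Lax-Oleinik operator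
  (\<open>ex_calibrated\<close>).
\<close>

section \<open>Periodic functions on the line\<close>

lemma periodic_int:
  fixes u :: "real \<Rightarrow> 'a"
  assumes "\<And>x. u (x + 1) = u x"
  shows "u (x + of_int k) = u x"
proof -
  have nat: "u (x + real n) = u x" for x n
  proof (induction n)
    case (Suc n)
    have "u (x + real (Suc n)) = u ((x + real n) + 1)" by (simp add: algebra_simps)
    then show ?case using assms Suc by simp
  qed simp
  show ?thesis
  proof (cases "k \<ge> 0")
    case True
    then show ?thesis using nat[of x "nat k"] by simp
  next
    case False
    then show ?thesis using nat[of "x + of_int k" "nat (-k)"] by simp
  qed
qed

lemma diagonal_periodic_int:
  fixes G :: "real \<times> real \<Rightarrow> 'a"
  assumes "\<And>x y. G (x + 1, y + 1) = G (x, y)"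
  shows "G (x + of_int k, y + of_int k) = G (x, y)"
  using periodic_int[of "\<lambda>t. G (x + t, y + t)" 0 k] assms
  by (simp add: add.assoc[symmetric])

text \<open>A strip around the diagonal is compact modulo the diagonal translation.\<close>

lemma diagonal_periodic_bounded_on_strip:
  fixes G :: "real \<times> real \<Rightarrow> 'a::real_normed_vector"
  assumes cont: "continuous_on UNIV G" and per: "\<And>x y. G (x + 1, y + 1) = G (x, y)"
  obtains M where "M \<ge> 0" "\<And>x y. \<bar>x - y\<bar> \<le> R \<Longrightarrow> norm (G (x, y)) \<le> M"
proof -
  let ?B = "{0..1} \<times> {-R..R+1}"
  have "compact (G ` ?B)"
    by (intro compact_continuous_image continuous_on_subset[OF cont] compact_Times) auto
  then obtain M where M: "\<And>z. z \<in> ?B \<Longrightarrow> norm (G z) \<le> M"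
    by (meson bounded_iff compact_imp_bounded image_eqI)
  show ?thesis
  proof (rule that[of "max M 0"])
    fix x y :: real assume "\<bar>x - y\<bar> \<le> R"
    let ?k = "\<lfloor>x\<rfloor>"
    have "(x - of_int ?k, y - of_int ?k) \<in> ?B"
      using \<open>\<bar>x - y\<bar> \<le> R\<close> by (auto simp: abs_le_iff) linarith+
    then show "norm (G (x, y)) \<le> max M 0"
      using M[of "(x - of_int ?k, y - of_int ?k)"] diagonal_periodic_int[of G, OF per, of "x - of_int ?k" ?k "y - of_int ?k"]
      by simp
  qed simp
qed

text \<open>Points further apart than \<open>1\<close> can be brought within distance \<open>1\<close> by an integer translation, which does
  not change the values.\<close>

lemma periodic_locally_lipschitz:
  fixes w :: "real \<Rightarrow> real"
  assumes per: "\<And>x. w (x + 1) = w x" and L: "L \<ge> 0"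
    and loc: "\<And>x y. \<bar>x - y\<bar> \<le> 1 \<Longrightarrow> \<bar>w x - w y\<bar> \<le> L * \<bar>x - y\<bar>"
  shows "\<bar>w x - w y\<bar> \<le> L * \<bar>x - y\<bar>"
proof (cases "\<bar>x - y\<bar> \<le> 1")
  case False
  let ?k = "\<lfloor>x - y\<rfloor>"
  have "\<bar>(x - of_int ?k) - y\<bar> \<le> 1" by linarith
  then have "\<bar>w (x - of_int ?k) - w y\<bar> \<le> L * 1"
    by (meson L loc mult_left_mono order_trans)
  moreover have "w (x - of_int ?k) = w x" using periodic_int[of w x "-?k", OF per] by simp
  moreover have "L * 1 \<le> L * \<bar>x - y\<bar>" using False L by (intro mult_left_mono) auto
  ultimately show ?thesis by simp
qed (rule loc)

text \<open>Equicontinuity gives a subsequence that converges uniformly on \<open>[0, 1]\<close>; the limit is then extended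
  periodically by means of \<open>frac\<close>.\<close>

lemma periodic_Arzela_Ascoli:
  fixes w :: "nat \<Rightarrow> real \<Rightarrow> real"
  assumes per: "\<And>n x. w n (x + 1) = w n x"
    and lip: "\<And>n x y. \<bar>w n x - w n y\<bar> \<le> L * \<bar>x - y\<bar>"
    and bdd: "\<And>n. \<bar>w n 0\<bar> \<le> C"
  obtains v r where "strict_mono (r :: nat \<Rightarrow> nat)" "uniform_limit UNIV (\<lambda>n. w (r n)) v sequentially"
    "continuous_on UNIV v" "\<And>x. v (x + 1) = v x"
proof -
  have L: "L \<ge> 0" using lip[of 0 1 0] by simp
  have C: "norm (w n x) \<le> C + L" if "x \<in> {0..1}" for n x
  proof -
    have "L * \<bar>x - 0\<bar> \<le> L * 1" using that L by (intro mult_left_mono) auto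
    then show ?thesis using lip[of n x 0] bdd[of n] by simp
  qed
  obtain g and r :: "nat \<Rightarrow> nat" where r: "strict_mono r" and
    g: "\<And>e. 0 < e \<Longrightarrow> \<exists>N. \<forall>n x. n \<ge> N \<and> x \<in> {0..1} \<longrightarrow> norm (w (r n) x - g x) < e"
  proof (rule Arzela_Ascoli[of "{0..1::real}" w "C + L"])
    fix x e :: real assume "0 < e"
    have "L * norm (x - y) < e" if "norm (x - y) < e / (L + 1)" for y
    proof -
      have "L * norm (x - y) \<le> L * (e / (L + 1))" using that L by (intro mult_left_mono) auto
      also have "\<dots> < e" using L \<open>0 < e\<close> by (simp add: divide_simps)
      finally show ?thesis .
    qed
    then have "norm (w n x - w n y) < e" if "norm (x - y) < e / (L + 1)" for n y
      using lip[of n x y] that by (fastforce intro: order_le_less_trans)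
    then show "\<exists>d>0. \<forall>n y. y \<in> {0..1} \<and> norm (x - y) < d \<longrightarrow> norm (w n x - w n y) < e"
      using L \<open>0 < e\<close> by (intro exI[of _ "e / (L + 1)"]) auto
  qed (use C in auto)
  define v where "v x = g (frac x)" for x
  have wf: "w n (frac x) = w n x" for n x
    using periodic_int[of "w n" x "-\<lfloor>x\<rfloor>", OF per] by (simp add: frac_def)
  have ul: "uniform_limit UNIV (\<lambda>n. w (r n)) v sequentially"
    unfolding uniform_limit_iff
  proof (intro allI impI)
    fix e :: real assume "e > 0"
    then obtain N where N: "\<And>n x. n \<ge> N \<Longrightarrow> x \<in> {0..1} \<Longrightarrow> norm (w (r n) x - g x) < e"
      using g by blast
    have "dist (w (r n) x) (v x) < e" if "n \<ge> N" for n x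
      using N[OF that, of "frac x"] wf[of "r n" x] frac_lt_1[of x]
      by (auto simp: dist_norm v_def)
    then show "\<forall>\<^sub>F n in sequentially. \<forall>x\<in>UNIV. dist (w (r n) x) (v x) < e"
      by (auto intro: eventually_sequentiallyI)
  qed
  have cw: "continuous_on UNIV (w n)" for n
    by (rule lipschitz_on_continuous_on[of L]) (auto intro!: lipschitz_onI L simp: lip dist_real_def)
  have cont: "continuous_on UNIV v"
    by (rule uniform_limit_theorem[OF _ ul]) (auto intro: cw always_eventually)
  have "v (x + 1) = v x" for x by (simp add: v_def frac_def)
  with r ul cont that show ?thesis by blast
qed

definition circle_fun :: "(real \<Rightarrow> real) \<Rightarrow> bool" where
  "circle_fun u \<longleftrightarrow> continuous_on UNIV u \<and> (\<forall>x. u (x + 1) = u x)"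

lemma circle_fun_int: "circle_fun u \<Longrightarrow> u (x + of_int k) = u x"
  using periodic_int unfolding circle_fun_def by blast

lemma circle_fun_lipschitz:
  assumes "\<And>x y. \<bar>u x - u y\<bar> \<le> L * \<bar>x - y\<bar>" "\<And>x. u (x + 1) = u x"
  shows "circle_fun u"
proof -
  have "L \<ge> 0" using assms(1)[of 0 1] by simp
  then have "L-lipschitz_on UNIV u" by (auto intro!: lipschitz_onI simp: assms(1) dist_real_def)
  then show ?thesis using assms(2) by (auto simp: circle_fun_def lipschitz_on_continuous_on)
qed

lemma periodic_lipschitz_oscillation:
  fixes u :: "real \<Rightarrow> real"
  assumes "\<And>x y. \<bar>u x - u y\<bar> \<le> L * \<bar>x - y\<bar>" "\<And>x. u (x + 1) = u x"
  shows "\<bar>u x - u 0\<bar> \<le> L"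
proof -
  have "L \<ge> 0" using assms(1)[of 0 1] by simp
  then have "L * \<bar>frac x - 0\<bar> \<le> L * 1"
    by (intro mult_left_mono) (auto simp: less_imp_le[OF frac_lt_1])
  moreover have "u (frac x) = u x"
    using periodic_int[of u x "-\<lfloor>x\<rfloor>", OF assms(2)] by (simp add: frac_def)
  ultimately show ?thesis using assms(1)[of "frac x" 0] by simp
qed

lemma circle_fun_bounded:
  assumes "circle_fun u"
  obtains B where "\<And>x. \<bar>u x\<bar> \<le> B"
proof -
  have "compact (u ` {0..1})"
    using assms by (intro compact_continuous_image) (auto simp: circle_fun_def intro: continuous_on_subset)
  then obtain B where B: "\<And>x. x \<in> {0..1} \<Longrightarrow> norm (u x) \<le> B"
    by (meson bounded_iff compact_imp_bounded image_eqI)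
  have "\<bar>u x\<bar> \<le> B" for x
  proof -
    have "u (frac x) = u x" using circle_fun_int[OF assms, of x "-\<lfloor>x\<rfloor>"] by (simp add: frac_def)
    then show ?thesis using B[of "frac x"] by (simp add: less_imp_le[OF frac_lt_1])
  qed
  then show ?thesis using that by blast
qed

section \<open>Derivatives of touching functions and of convex functions\<close>

lemma derivative_eq_if_touching:
  fixes g h :: "real \<Rightarrow> real"
  assumes "(g has_real_derivative a) (at x)" "(h has_real_derivative b) (at x)"
    and "\<And>t. g t \<le> h t" "g x = h x"
  shows "a = b"
proof -
  have "((\<lambda>t. g t - h t) has_real_derivative a - b) (at x)"
    using assms by (intro DERIV_diff)
  then have "a - b = 0"
    by (rule DERIV_local_max[of _ _ _ 1]) (use assms in auto)
  then show ?thesis by simp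
qed

text \<open>This yields differentiability of a weak K.A.M. solution, about which only continuity is known
  beforehand, at points where smooth functions touch it from both sides.\<close>

lemma derivative_squeeze:
  fixes g h w :: "real \<Rightarrow> real"
  assumes g: "(g has_real_derivative a) (at x)" and h: "(h has_real_derivative b) (at x)"
    and le: "\<And>t. g t \<le> w t" "\<And>t. w t \<le> h t" and eq: "g x = w x" "h x = w x"
  shows "(w has_real_derivative a) (at x)"
proof -
  have ab: "a = b"
    by (rule derivative_eq_if_touching[OF g h]) (use le eq order_trans in \<open>auto, blast\<close>)
  have lim: "((\<lambda>t. \<bar>(g t - g x) / (t - x) - a\<bar> + \<bar>(h t - h x) / (t - x) - a\<bar>) \<longlongrightarrow> 0) (at x)"
    using tendsto_add[OF tendsto_rabs[OF tendsto_diff[OF g[unfolded has_field_derivative_iff] tendsto_const[of a]]]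
        tendsto_rabs[OF tendsto_diff[OF h[unfolded has_field_derivative_iff ab[symmetric]] tendsto_const[of a]]]]
    by simp
  have "((\<lambda>t. (w t - w x) / (t - x) - a) \<longlongrightarrow> 0) (at x)"
  proof (rule Lim_null_comparison[OF _ lim])
    show "\<forall>\<^sub>F t in at x. norm ((w t - w x) / (t - x) - a)
        \<le> \<bar>(g t - g x) / (t - x) - a\<bar> + \<bar>(h t - h x) / (t - x) - a\<bar>"
    proof (rule eventuallyI)
      fix t
      have "min ((g t - g x) / (t - x)) ((h t - h x) / (t - x)) \<le> (w t - w x) / (t - x) \<and>
        (w t - w x) / (t - x) \<le> max ((g t - g x) / (t - x)) ((h t - h x) / (t - x))"
        using le[of t] eq by (cases "t \<ge> x") (auto simp: min_le_iff_disj le_max_iff_disj divide_right_mono divide_right_mono_neg)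
      then show "norm ((w t - w x) / (t - x) - a)
        \<le> \<bar>(g t - g x) / (t - x) - a\<bar> + \<bar>(h t - h x) / (t - x) - a\<bar>"
        by (auto simp: min_def max_def split: if_splits)
    qed
  qed
  then show ?thesis
    unfolding has_field_derivative_iff using LIM_zero_iff by blast
qed

text \<open>The inequality at \<open>c\<close> and the one at \<open>x\<close> enclose the difference quotient between \<open>\<rho> c\<close> and \<open>\<rho> x\<close>.\<close>

lemma has_derivative_if_continuous_subgradient:
  fixes a \<rho> :: "real \<Rightarrow> real"
  assumes sub: "\<And>x y. a y \<ge> a x + \<rho> x * (y - x)" and cont: "isCont \<rho> c"
  shows "(a has_real_derivative \<rho> c) (at c)"
proof -
  have "((\<lambda>x. (a x - a c) / (x - c) - \<rho> c) \<longlongrightarrow> 0) (at c)"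
  proof (rule Lim_null_comparison)
    show "((\<lambda>x. \<bar>\<rho> x - \<rho> c\<bar>) \<longlongrightarrow> 0) (at c)"
      using tendsto_rabs_zero[OF LIM_zero[OF cont[unfolded isCont_def]]] .
    have "norm ((a x - a c) / (x - c) - \<rho> c) \<le> \<bar>\<rho> x - \<rho> c\<bar>" if "x \<noteq> c" for x
    proof -
      have "\<bar>(a x - a c) - \<rho> c * (x - c)\<bar> \<le> (\<rho> x - \<rho> c) * (x - c)"
        using sub[of c x] sub[of x c] by (simp add: abs_le_iff algebra_simps)
      also have "\<dots> \<le> \<bar>\<rho> x - \<rho> c\<bar> * \<bar>x - c\<bar>" by (simp add: abs_mult[symmetric])
      finally have "\<bar>(a x - a c) - \<rho> c * (x - c)\<bar> / \<bar>x - c\<bar> \<le> \<bar>\<rho> x - \<rho> c\<bar>"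
        using that by (simp add: pos_divide_le_eq)
      moreover have "(a x - a c) / (x - c) - \<rho> c = ((a x - a c) - \<rho> c * (x - c)) / (x - c)"
        using that by (simp add: field_simps)
      ultimately show ?thesis by simp
    qed
    then show "\<forall>\<^sub>F x in at c. norm ((a x - a c) / (x - c) - \<rho> c) \<le> \<bar>\<rho> x - \<rho> c\<bar>"
      by (auto simp: eventually_at_filter)
  qed
  then show ?thesis unfolding has_field_derivative_iff by (rule LIM_zero_cancel)
qed

section \<open>Rotation numbers of monotone maps of degree one\<close>

text \<open>The intervals \<open>[(b n - K) / n, (b n + K) / n]\<close> intersect pairwise, because \<open>b (m * n)\<close> is
  close both to \<open>m * b n\<close> and to \<open>n * b m\<close>; the supremum of the left endpoints lies in all of them.
  This produces the rotation number as well as the constant of the weak K.A.M. equation.\<close>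

lemma almost_additive_rate:
  fixes b :: "nat \<Rightarrow> real"
  assumes add: "\<And>m n. \<bar>b (m + n) - b m - b n\<bar> \<le> K"
  shows "\<exists>r. \<forall>n. \<bar>b n - real n * r\<bar> \<le> K"
proof -
  have K: "K \<ge> 0" using add[of 0 0] by linarith
  have mult: "\<bar>b (Suc m * n) - real (Suc m) * b n\<bar> \<le> real m * K" for m n
  proof (induction m)
    case (Suc m)
    have "b (Suc (Suc m) * n) = b (n + Suc m * n)" by simp
    moreover have "real (Suc (Suc m)) * b n = b n + real (Suc m) * b n" "real (Suc m) * K = real m * K + K"
      by (simp_all add: algebra_simps)
    ultimately show ?case using add[of n "Suc m * n"] Suc by linarith
  qed simp
  have mult': "\<bar>b (m * n) - real m * b n\<bar> \<le> real m * K" if m: "m \<ge> 1" for m n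
  proof -
    obtain k where k: "m = Suc k" using m by (cases m) auto
    have "real k * K \<le> real m * K" using K k by (intro mult_right_mono) auto
    then show ?thesis using mult[of k n] unfolding k by linarith
  qed
  have cross: "(b n - K) / n \<le> (b m + K) / m" if "m \<ge> 1" "n \<ge> 1" for m n :: nat
  proof -
    have "real m * b n - real n * b m \<le> (real m + real n) * K"
      using mult'[OF that(1), of n] mult'[OF that(2), of m] by (simp add: mult.commute algebra_simps)
    then show ?thesis using that by (simp add: divide_simps algebra_simps)
  qed
  define r where "r = (SUP n\<in>{1..}. (b n - K) / real n)"
  have "\<bar>b n - real n * r\<bar> \<le> K" for n
  proof (cases "n = 0")
    case True
    then show ?thesis using add[of 0 0] by simp
  next
    case False
    then have n: "n \<ge> 1" by simp
    have "(b n - K) / n \<le> r"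
      unfolding r_def by (rule cSUP_upper) (use n cross[OF n] in \<open>auto intro!: bdd_aboveI2\<close>)
    moreover have "r \<le> (b n + K) / n"
      unfolding r_def by (rule cSUP_least) (use cross[OF n] in auto)
    ultimately show ?thesis using n by (simp add: divide_simps abs_le_iff) (simp add: algebra_simps)
  qed
  then show ?thesis by blast
qed

text \<open>The uniform bound on the deviation from the linear motion is stronger than the existence of the
  limit, and it survives limits of maps for a fixed number of steps, which is what makes the
  rotation number continuous. The constant \<open>2\<close> is one unit for the initial point and one for almost
  additivity.\<close>

definition rotates :: "(real \<Rightarrow> real) \<Rightarrow> real \<Rightarrow> bool" where
  "rotates g \<rho> \<longleftrightarrow> (\<forall>n x. \<bar>(g ^^ n) x - x - real n * \<rho>\<bar> \<le> 2)"

lemma degree_one_rotates: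
  fixes g :: "real \<Rightarrow> real"
  assumes mono: "mono g" and deg: "\<And>x. g (x + 1) = g x + 1"
  shows "\<exists>\<rho>. rotates g \<rho>"
proof -
  have deg_n: "(g ^^ n) (x + 1) = (g ^^ n) x + 1" for n x
    by (induction n) (auto simp: deg)
  have deg_int: "(g ^^ n) (x + of_int k) = (g ^^ n) x + of_int k" for n x k
    using periodic_int[of "\<lambda>x. (g ^^ n) x - x" x k] deg_n by (simp add: algebra_simps)
  have mono_n: "mono (g ^^ n)" for n by (induction n) (auto simp: mono_def monoD[OF mono])
  \<comment> \<open>The displacement of \<open>g ^^ n\<close> at \<open>x\<close> is compared with that at the neighbouring integers, where it
    equals the displacement at \<open>0\<close>.\<close>
  have near: "\<bar>(g ^^ n) x - x - (g ^^ n) 0\<bar> \<le> 1" for n x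
  proof -
    have "(g ^^ n) (0 + of_int \<lfloor>x\<rfloor>) \<le> (g ^^ n) x"
      by (rule monoD[OF mono_n]) simp
    moreover have "(g ^^ n) x \<le> (g ^^ n) (0 + of_int (\<lfloor>x\<rfloor> + 1))"
      by (rule monoD[OF mono_n]) (simp add: less_imp_le)
    ultimately show ?thesis unfolding deg_int by (simp add: abs_le_iff) linarith
  qed
  have "\<bar>(g ^^ (m + n)) 0 - (g ^^ m) 0 - (g ^^ n) 0\<bar> \<le> 1" for m n
    using near[of m "(g ^^ n) 0"] by (simp add: funpow_add algebra_simps)
  then obtain \<rho> where \<rho>: "\<And>n. \<bar>(g ^^ n) 0 - real n * \<rho>\<bar> \<le> 1"
    using almost_additive_rate[of "\<lambda>n. (g ^^ n) 0" 1] by blast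
  have "\<bar>(g ^^ n) x - x - real n * \<rho>\<bar> \<le> 2" for n x
    using near[of n x] \<rho>[of n] by linarith
  then show ?thesis unfolding rotates_def by blast
qed

lemma zero_if_multiples_bounded:
  fixes a :: real
  assumes "\<And>n. real n * a \<le> B"
  shows "a \<le> 0"
proof (rule ccontr)
  assume "\<not> a \<le> 0"
  then obtain n :: nat where "B < real n * a" using ex_less_of_nat_mult[of a B] by auto
  then show False using assms[of n] by simp
qed

lemma rotates_tendsto:
  assumes "rotates g \<rho>"
  shows "(\<lambda>n. ((g ^^ n) x - x) / real n) \<longlonglongrightarrow> \<rho>"
proof -
  have "(\<lambda>n. 2 / real n) \<longlonglongrightarrow> 0" by (rule lim_const_over_n)
  then have "(\<lambda>n. ((g ^^ n) x - x) / real n - \<rho>) \<longlonglongrightarrow> 0"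
  proof (rule Lim_null_comparison[rotated])
    show "\<forall>\<^sub>F n in sequentially. norm (((g ^^ n) x - x) / real n - \<rho>) \<le> 2 / real n"
    proof (rule eventually_sequentiallyI[of 1])
      fix n :: nat assume "1 \<le> n"
      then have "((g ^^ n) x - x) / real n - \<rho> = ((g ^^ n) x - x - real n * \<rho>) / real n"
        by (simp add: field_simps)
      moreover have "\<bar>(g ^^ n) x - x - real n * \<rho>\<bar> \<le> 2" using assms by (simp add: rotates_def)
      ultimately show "norm (((g ^^ n) x - x) / real n - \<rho>) \<le> 2 / real n"
        by (simp add: divide_right_mono)
    qed
  qed
  then show ?thesis by (rule LIM_zero_cancel)
qed

section \<open>Generating functions with twist\<close>

text \<open>These are the properties of the generating function on which the proof rests; the class \<open>c\<close> varies
  in the arguments about Mather's function and is therefore not a parameter here.\<close>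

locale twist_generating =
  fixes S :: "real \<times> real \<Rightarrow> real" and e :: real
  assumes C2: "C2 S"
    and diagonal_periodic: "\<And>x y. S (x + 1, y + 1) = S (x, y)"
    and e_pos: "e > 0"
    and twist: "\<And>z. partial1 (partial2 S) z < - e"
begin

lemma total_derivative:
  obtains D :: "real \<times> real \<Rightarrow> (real \<times> real) \<Rightarrow>\<^sub>L real" and D'
  where "\<And>z. (S has_derivative blinfun_apply (D z)) (at z)"
    "\<And>z. (D has_derivative blinfun_apply (D' z)) (at z)" "continuous_on UNIV D'"
    "\<And>z. partial1 S z = D z (1, 0)" "\<And>z. partial2 S z = D z (0, 1)"
    "\<And>x y. ((\<lambda>t. S (t, y)) has_real_derivative partial1 S (x, y)) (at x)"
    "\<And>x y. ((\<lambda>t. S (x, t)) has_real_derivative partial2 S (x, y)) (at y)"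
proof -
  obtain D :: "real \<times> real \<Rightarrow> (real \<times> real) \<Rightarrow>\<^sub>L real" and D'
    where D: "\<And>z. (S has_derivative blinfun_apply (D z)) (at z)"
    and D': "\<And>z. (D has_derivative blinfun_apply (D' z)) (at z)" "continuous_on UNIV D'"
    using C2 unfolding C2_def C1_def by blast
  have 1: "((\<lambda>t. S (t, y)) has_real_derivative D (x, y) (1, 0)) (at x)" for x y
  proof -
    have "((\<lambda>t. (t, y)) has_derivative (\<lambda>h. (h, 0))) (at x)"
      by (auto intro!: derivative_eq_intros)
    from has_derivative_compose[OF this D[of "(x, y)"]]
    have "((\<lambda>t. S (t, y)) has_derivative (\<lambda>h. D (x, y) (h, 0))) (at x)" .
    moreover have "(\<lambda>h. D (x, y) (h, 0)) = (*) (D (x, y) (1, 0))"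
    proof
      fix h
      have "(h, 0) = h *\<^sub>R ((1, 0) :: real \<times> real)" by simp
      then show "D (x, y) (h, 0) = D (x, y) (1, 0) * h"
        by (simp only: blinfun.scaleR_right) simp
    qed
    ultimately show ?thesis by (simp only: has_field_derivative_def)
  qed
  have 2: "((\<lambda>t. S (x, t)) has_real_derivative D (x, y) (0, 1)) (at y)" for x y
  proof -
    have "((\<lambda>t. (x, t)) has_derivative (\<lambda>h. (0, h))) (at y)"
      by (auto intro!: derivative_eq_intros)
    from has_derivative_compose[OF this D[of "(x, y)"]]
    have "((\<lambda>t. S (x, t)) has_derivative (\<lambda>h. D (x, y) (0, h))) (at y)" .
    moreover have "(\<lambda>h. D (x, y) (0, h)) = (*) (D (x, y) (0, 1))"
    proof
      fix h
      have "(0, h) = h *\<^sub>R ((0, 1) :: real \<times> real)" by simp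
      then show "D (x, y) (0, h) = D (x, y) (0, 1) * h"
        by (simp only: blinfun.scaleR_right) simp
    qed
    ultimately show ?thesis by (simp only: has_field_derivative_def)
  qed
  have p1: "partial1 S z = D z (1, 0)" for z
    unfolding partial1_def using 1[of "snd z" "fst z"] DERIV_imp_deriv by fastforce
  have p2: "partial2 S z = D z (0, 1)" for z
    unfolding partial2_def using 2[of "fst z" "snd z"] DERIV_imp_deriv by fastforce
  show ?thesis
    by (rule that[OF D D' p1 p2]) (use 1 2 p1 p2 in auto)
qed

lemma DERIV_S1: "((\<lambda>t. S (t, y)) has_real_derivative partial1 S (x, y)) (at x)"
  and DERIV_S2: "((\<lambda>t. S (x, t)) has_real_derivative partial2 S (x, y)) (at y)"
  using total_derivative by blast+

lemma continuous_S: "continuous_on A S"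
  using total_derivative by (metis continuous_at_imp_continuous_on has_derivative_continuous)

lemma continuous_partial2: "continuous_on A (partial2 S)"
proof -
  obtain D :: "real \<times> real \<Rightarrow> (real \<times> real) \<Rightarrow>\<^sub>L real" and D'
    where D': "\<And>z. (D has_derivative blinfun_apply (D' z)) (at z)"
    and p: "\<And>z. partial2 S z = D z (0, 1)"
    using total_derivative by metis
  have "continuous_on A D"
    by (intro continuous_at_imp_continuous_on ballI has_derivative_continuous[OF D'])
  moreover have "partial2 S = (\<lambda>z. D z (0, 1))" using p by auto
  ultimately show ?thesis
    by (auto intro!: continuous_intros)
qed

lemma partials_diagonal_periodic:
  "partial1 S (x + 1, y + 1) = partial1 S (x, y)" "partial2 S (x + 1, y + 1) = partial2 S (x, y)"
proof -
  have "((\<lambda>t. S (t + 1, y + 1)) has_real_derivative partial1 S (x + 1, y + 1)) (at x)"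
    using DERIV_S1[of "y + 1" "x + 1"] by (simp add: DERIV_shift)
  then show "partial1 S (x + 1, y + 1) = partial1 S (x, y)"
    unfolding diagonal_periodic using DERIV_S1 DERIV_unique by blast
  have "((\<lambda>t. S (x + 1, t + 1)) has_real_derivative partial2 S (x + 1, y + 1)) (at y)"
    using DERIV_S2[of "x + 1" "y + 1"] by (simp add: DERIV_shift)
  then show "partial2 S (x + 1, y + 1) = partial2 S (x, y)"
    unfolding diagonal_periodic using DERIV_S2 DERIV_unique by blast
qed

text \<open>The second derivative of \<open>S\<close> is bounded on a ball that contains the relevant points once the first
  coordinate has been translated into \<open>[0, 1]\<close>.\<close>

lemma partials_lipschitz_on_strip:
  obtains K where "K \<ge> 0"
    "\<And>x y x' y'. \<lbrakk>\<bar>x - y\<bar> \<le> R; \<bar>x' - x\<bar> \<le> 1; \<bar>y' - y\<bar> \<le> 1\<rbrakk> \<Longrightarrow>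
       \<bar>partial1 S (x', y') - partial1 S (x, y)\<bar> \<le> K * (\<bar>x' - x\<bar> + \<bar>y' - y\<bar>)"
    "\<And>x y x' y'. \<lbrakk>\<bar>x - y\<bar> \<le> R; \<bar>x' - x\<bar> \<le> 1; \<bar>y' - y\<bar> \<le> 1\<rbrakk> \<Longrightarrow>
       \<bar>partial2 S (x', y') - partial2 S (x, y)\<bar> \<le> K * (\<bar>x' - x\<bar> + \<bar>y' - y\<bar>)"
proof -
  obtain D :: "real \<times> real \<Rightarrow> (real \<times> real) \<Rightarrow>\<^sub>L real" and D'
    where D': "\<And>z. (D has_derivative blinfun_apply (D' z)) (at z)" "continuous_on UNIV D'"
    and p: "\<And>z. partial1 S z = D z (1, 0)" "\<And>z. partial2 S z = D z (0, 1)"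
    using total_derivative by metis
  define B where "B = cball (0 :: real \<times> real) (\<bar>R\<bar> + 5)"
  have "compact (D' ` B)"
    unfolding B_def by (intro compact_continuous_image continuous_on_subset[OF D'(2)]) auto
  then obtain K where K: "\<And>z. z \<in> B \<Longrightarrow> norm (D' z) \<le> K"
    by (meson bounded_iff compact_imp_bounded image_eqI)
  have "0 \<in> B" by (simp add: B_def)
  from K[OF this] have K0: "K \<ge> 0" using norm_ge_zero order_trans by blast
  have lip: "norm (D z' - D z) \<le> K * norm (z' - z)" if "z \<in> B" "z' \<in> B" for z z'
    by (rule differentiable_bound[of B _ "\<lambda>z. blinfun_apply (D' z)"])
      (use K that D'(1) in \<open>auto simp: B_def norm_blinfun.rep_eq[symmetric] intro: has_derivative_at_withinI\<close>)
  have key: "norm (D (x' - of_int \<lfloor>x\<rfloor>, y' - of_int \<lfloor>x\<rfloor>) - D (x - of_int \<lfloor>x\<rfloor>, y - of_int \<lfloor>x\<rfloor>))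
      \<le> K * (\<bar>x' - x\<bar> + \<bar>y' - y\<bar>)"
    if "\<bar>x - y\<bar> \<le> R" "\<bar>x' - x\<bar> \<le> 1" "\<bar>y' - y\<bar> \<le> 1" for x y x' y'
  proof -
    let ?k = "of_int \<lfloor>x\<rfloor> :: real"
    have n: "norm (a, b) \<le> \<bar>a\<bar> + \<bar>b\<bar>" for a b :: real
      using norm_Pair_le[of a b] by simp
    have f: "0 \<le> x - ?k" "x - ?k \<le> 1" by linarith+
    have "(x - ?k, y - ?k) \<in> B" "(x' - ?k, y' - ?k) \<in> B"
      using n[of "x - ?k" "y - ?k"] n[of "x' - ?k" "y' - ?k"] f that
      unfolding B_def mem_cball_0 by linarith+
    from lip[OF this]
    have "norm (D (x' - ?k, y' - ?k) - D (x - ?k, y - ?k)) \<le> K * norm (x' - x, y' - y)"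
      by simp
    also have "\<dots> \<le> K * (\<bar>x' - x\<bar> + \<bar>y' - y\<bar>)"
      using n K0 by (intro mult_left_mono) auto
    finally show ?thesis .
  qed
  have P: "partial1 S (x - of_int k, y - of_int k) = partial1 S (x, y)"
    "partial2 S (x - of_int k, y - of_int k) = partial2 S (x, y)" for x y k
    using diagonal_periodic_int[of "partial1 S", OF partials_diagonal_periodic(1), of x "-k" y]
      diagonal_periodic_int[of "partial2 S", OF partials_diagonal_periodic(2), of x "-k" y] by auto
  have app: "\<bar>A v - A' v\<bar> \<le> norm (A - A')" if "norm v = 1" for A A' :: "(real \<times> real) \<Rightarrow>\<^sub>L real" and v
    using norm_blinfun[of "A - A'" v] that by (simp add: blinfun.diff_left)
  show ?thesis
  proof (rule that[OF K0])
    fix x y x' y' :: real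
    assume *: "\<bar>x - y\<bar> \<le> R" "\<bar>x' - x\<bar> \<le> 1" "\<bar>y' - y\<bar> \<le> 1"
    let ?k = "\<lfloor>x\<rfloor>"
    show "\<bar>partial1 S (x', y') - partial1 S (x, y)\<bar> \<le> K * (\<bar>x' - x\<bar> + \<bar>y' - y\<bar>)"
    proof -
      have "norm (1 :: real, 0 :: real) = 1" by simp
      from app[OF this] key[OF *]
      have "\<bar>D (x' - of_int ?k, y' - of_int ?k) (1 :: real, 0 :: real) - D (x - of_int ?k, y - of_int ?k) (1 :: real, 0 :: real)\<bar>
          \<le> K * (\<bar>x' - x\<bar> + \<bar>y' - y\<bar>)"
        by (rule order_trans)
      then show ?thesis
        unfolding p(1)[symmetric] P(1) .
    qed
    show "\<bar>partial2 S (x', y') - partial2 S (x, y)\<bar> \<le> K * (\<bar>x' - x\<bar> + \<bar>y' - y\<bar>)"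
    proof -
      have "norm (0 :: real, 1 :: real) = 1" by simp
      from app[OF this] key[OF *]
      have "\<bar>D (x' - of_int ?k, y' - of_int ?k) (0 :: real, 1 :: real) - D (x - of_int ?k, y - of_int ?k) (0 :: real, 1 :: real)\<bar>
          \<le> K * (\<bar>x' - x\<bar> + \<bar>y' - y\<bar>)"
        by (rule order_trans)
      then show ?thesis
        unfolding p(2)[symmetric] P(2) .
    qed
  qed
qed

lemma partial2_decreasing:
  assumes "a \<le> b"
  shows "partial2 S (b, y) \<le> partial2 S (a, y) - e * (b - a)"
proof (cases "a = b")
  case False
  obtain D :: "real \<times> real \<Rightarrow> (real \<times> real) \<Rightarrow>\<^sub>L real" and D'
    where D': "\<And>z. (D has_derivative blinfun_apply (D' z)) (at z)"
    and p: "\<And>z. partial2 S z = D z (0, 1)"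
    using total_derivative by metis
  have "(\<lambda>t. partial2 S (t, y)) differentiable (at x)" for x
  proof -
    have "((\<lambda>t. (t, y)) has_derivative (\<lambda>h. (h, 0))) (at x)"
      by (auto intro!: derivative_eq_intros)
    from has_derivative_compose[OF this D'[of "(x, y)"]]
    have "((\<lambda>t. D (t, y)) has_derivative (\<lambda>h. D' (x, y) (h, 0))) (at x)" .
    from bounded_linear.has_derivative[OF blinfun.bounded_linear_left this]
    have "(\<lambda>t. D (t, y) (0, 1)) differentiable (at x)"
      by (auto simp: differentiable_def)
    then show ?thesis by (simp add: p)
  qed
  then have "((\<lambda>t. partial2 S (t, y)) has_real_derivative partial1 (partial2 S) (x, y)) (at x)" for x
    unfolding partial1_def by (simp add: DERIV_deriv_iff_real_differentiable)
  from MVT2[OF _ this, of a b] False assms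
  obtain z where "partial2 S (b, y) - partial2 S (a, y) = (b - a) * partial1 (partial2 S) (z, y)"
    by auto
  moreover have "(b - a) * partial1 (partial2 S) (z, y) \<le> (b - a) * (- e)"
    using twist[of "(z, y)"] assms by (intro mult_left_mono) auto
  ultimately show ?thesis by (simp add: algebra_simps)
qed simp

text \<open>This is the twist condition integrated over the rectangle \<open>[a, b] \<times> [x, y]\<close>. It says that crossing
  pairs cost strictly more than uncrossed ones, and monotonicity of optimal maps follows from it.\<close>

lemma twist_inequality:
  assumes "a \<le> b" "x \<le> y"
  shows "S (a, x) + S (b, y) + e * (b - a) * (y - x) \<le> S (a, y) + S (b, x)"
proof (cases "x = y")
  case False
  have "((\<lambda>t. S (b, t) - S (a, t)) has_real_derivative partial2 S (b, t) - partial2 S (a, t)) (at t)" for t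
    by (intro DERIV_diff DERIV_S2)
  from MVT2[OF _ this, of x y] False assms
  obtain z where "(S (b, y) - S (a, y)) - (S (b, x) - S (a, x))
      = (y - x) * (partial2 S (b, z) - partial2 S (a, z))"
    by auto
  moreover have "(y - x) * (partial2 S (b, z) - partial2 S (a, z)) \<le> (y - x) * (- (e * (b - a)))"
    using partial2_decreasing[OF assms(1), of z] assms by (intro mult_left_mono) auto
  ultimately show ?thesis by (simp add: algebra_simps)
qed simp

lemma partial1_decreasing:
  assumes "x \<le> y"
  shows "partial1 S (a, y) \<le> partial1 S (a, x) - e * (y - x)"
proof -
  \<comment> \<open>Deriving the bound from the rectangle inequality avoids exchanging the two partial
    derivatives of \<open>S\<close>.\<close>
  let ?g = "\<lambda>t. S (t, x) - S (t, y) - e * (y - x) * t"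
  have d: "(?g has_real_derivative partial1 S (a, x) - partial1 S (a, y) - e * (y - x)) (at a)"
    by (auto intro!: derivative_eq_intros DERIV_S1)
  have "?g s \<le> ?g t" if "s \<le> t" for s t
    using twist_inequality[OF that assms] by (simp add: algebra_simps)
  then have "0 \<le> partial1 S (a, x) - partial1 S (a, y) - e * (y - x)"
    by (intro mono_on_imp_deriv_nonneg[OF _ d, of UNIV]) (auto intro: mono_onI)
  then show ?thesis by simp
qed

lemma S_coh_eq: "S_coh S c (x, y) = S (x, y) + c * (x - y)"
  by (simp add: S_coh_def)

section \<open>Minimizers, maximizers and the Lax-Oleinik operator\<close>

lemma S_coh_periodic: "S_coh S c (x + 1, y + 1) = S_coh S c (x, y)"
  by (simp add: S_coh_eq diagonal_periodic)

lemma S_coh_int: "S_coh S c (x + of_int k, y + of_int k) = S_coh S c (x, y)"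
  by (rule diagonal_periodic_int) (rule S_coh_periodic)

lemma continuous_S_coh: "continuous_on A (S_coh S c)"
  unfolding S_coh_def case_prod_beta prod.collapse by (intro continuous_intros continuous_S)

text \<open>A superlinear growth of \<open>S\<close> would confine optimal points to a bounded distance from \<open>x\<close>. For
  periodic \<open>u\<close> it is enough that an integer translation, which leaves \<open>u\<close> unchanged, brings a far
  point within distance \<open>R\<close> of \<open>x\<close> and lowers the action. The radius must be uniform for
  \<open>\<bar>c\<bar> \<le> C\<close> because the class varies later.\<close>

definition reach :: "real \<Rightarrow> real \<Rightarrow> bool" where
  "reach C R \<longleftrightarrow> R \<ge> 1 \<and> (\<forall>c x y. \<bar>c\<bar> \<le> C \<longrightarrow> \<bar>y - x\<bar> > R \<longrightarrow>
     (\<exists>k. \<bar>y + of_int k - x\<bar> \<le> R \<and> S_coh S c (x, y + of_int k) < S_coh S c (x, y)))"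

text \<open>By the twist inequality on a rectangle of width \<open>1\<close>, moving \<open>y\<close> one unit towards \<open>x\<close> changes \<open>S (x, y)\<close>
  by at most \<open>2 * M - e * \<bar>y - x\<bar>\<close>, where \<open>M\<close> bounds \<open>S\<close> near the diagonal. Far from \<open>x\<close> this outweighs
  the change \<open>\<bar>c\<bar>\<close> of the linear term, and finitely many unit steps lead to the strip.\<close>

lemma ex_reach: obtains R where "reach C R"
proof -
  obtain M where M: "M \<ge> 0" "\<And>x y. \<bar>x - y\<bar> \<le> 1 \<Longrightarrow> norm (S (x, y)) \<le> M"
    using diagonal_periodic_bounded_on_strip[OF continuous_S diagonal_periodic, of 1] by blast
  define R where "R = max 1 ((2 * M + \<bar>C\<bar>) / e)"
  have far: "e * t > 2 * M + \<bar>c\<bar>" if "\<bar>c\<bar> \<le> C" "t > R" for c t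
  proof -
    have "(2 * M + \<bar>c\<bar>) / e \<le> (2 * M + \<bar>C\<bar>) / e"
      using that e_pos by (intro divide_right_mono) auto
    also have "\<dots> < t" using that by (simp add: R_def)
    finally show ?thesis using e_pos by (simp add: pos_divide_less_eq mult.commute)
  qed
  have right: "S_coh S c (x, y - 1) < S_coh S c (x, y)" if "\<bar>c\<bar> \<le> C" "y - x > R" for c x y
  proof -
    have "x \<le> y" using that by (simp add: R_def)
    from twist_inequality[of x "x + 1" x y, OF _ this]
    have "S (x, x) + S (x + 1, y) + e * (y - x) \<le> S (x, y) + S (x + 1, x)" by simp
    then show ?thesis
      using M(2)[of x x] M(2)[of "x + 1" x] far[OF that] diagonal_periodic[of x "y - 1"]
      by (auto simp: S_coh_eq algebra_simps)
  qed
  have left: "S_coh S c (x, y + 1) < S_coh S c (x, y)" if "\<bar>c\<bar> \<le> C" "x - y > R" for c x y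
  proof -
    have "y \<le> x" using that by (simp add: R_def)
    from twist_inequality[of "x - 1" x y x, OF _ this]
    have "S (x - 1, y) + S (x, x) + e * (x - y) \<le> S (x - 1, x) + S (x, y)" by simp
    then show ?thesis
      using M(2)[of x x] M(2)[of "x - 1" x] far[OF that] diagonal_periodic[of "x - 1" y]
      by (auto simp: S_coh_eq algebra_simps)
  qed
  have step: "\<exists>j. \<bar>y + of_int j - x\<bar> = \<bar>y - x\<bar> - 1 \<and> S_coh S c (x, y + of_int j) < S_coh S c (x, y)"
    if c: "\<bar>c\<bar> \<le> C" and y: "\<bar>y - x\<bar> > R" for c x y
  proof (cases "y > x")
    case True
    then have "y - x > R" using y by simp
    moreover have "R \<ge> 1" by (simp add: R_def)
    ultimately have "\<bar>y + of_int (-1) - x\<bar> = \<bar>y - x\<bar> - 1" by simp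
    with right[OF c \<open>y - x > R\<close>] show ?thesis by (intro exI[of _ "-1"]) auto
  next
    case False
    then have "x - y > R" using y by simp
    moreover have "R \<ge> 1" by (simp add: R_def)
    ultimately have "\<bar>y + of_int 1 - x\<bar> = \<bar>y - x\<bar> - 1" by simp
    with left[OF c \<open>x - y > R\<close>] show ?thesis by (intro exI[of _ 1]) auto
  qed
  have descent: "\<exists>k. \<bar>y + of_int k - x\<bar> \<le> R \<and> S_coh S c (x, y + of_int k) < S_coh S c (x, y)"
    if c: "\<bar>c\<bar> \<le> C" and "\<bar>y - x\<bar> > R" "\<bar>y - x\<bar> \<le> R + real n" for c x y n
    using that(2,3)
  proof (induction n arbitrary: y)
    case (Suc n)
    obtain j where j: "\<bar>y + of_int j - x\<bar> = \<bar>y - x\<bar> - 1" "S_coh S c (x, y + of_int j) < S_coh S c (x, y)"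
      using step[OF c Suc.prems(1)] by blast
    show ?case
    proof (cases "\<bar>y + of_int j - x\<bar> \<le> R")
      case False
      then obtain k where "\<bar>y + of_int j + of_int k - x\<bar> \<le> R"
        "S_coh S c (x, y + of_int j + of_int k) < S_coh S c (x, y + of_int j)"
        using Suc.IH[of "y + of_int j"] Suc.prems j by auto
      then show ?thesis using j by (intro exI[of _ "j + k"]) (auto simp: add.assoc)
    qed (use j in blast)
  qed simp
  have "reach C R"
    unfolding reach_def
  proof (intro conjI allI impI)
    fix c x y assume *: "\<bar>c\<bar> \<le> C" "\<bar>y - x\<bar> > R"
    obtain n where "\<bar>y - x\<bar> - R \<le> real n" using real_arch_simple by blast
    then show "\<exists>k. \<bar>y + of_int k - x\<bar> \<le> R \<and> S_coh S c (x, y + of_int k) < S_coh S c (x, y)"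
      by (intro descent[OF *, of n]) linarith
  qed (simp add: R_def)
  then show ?thesis using that by blast
qed

lemma reach_forward:
  assumes "reach C R" "\<bar>c\<bar> \<le> C" "circle_fun u" "\<bar>y - x\<bar> > R"
  obtains y' where "\<bar>y' - x\<bar> \<le> R" "u y' = u y" "S_coh S c (x, y') < S_coh S c (x, y)"
proof -
  obtain k where "\<bar>y + of_int k - x\<bar> \<le> R" "S_coh S c (x, y + of_int k) < S_coh S c (x, y)"
    using assms unfolding reach_def by blast
  then show ?thesis using that[of "y + of_int k"] circle_fun_int[OF assms(3)] by blast
qed

lemma reach_backward:
  assumes "reach C R" "\<bar>c\<bar> \<le> C" "circle_fun u" "\<bar>y - x\<bar> > R"
  obtains y' where "\<bar>y' - x\<bar> \<le> R" "u y' = u y" "S_coh S c (y', x) < S_coh S c (y, x)"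
proof -
  have "\<bar>x - y\<bar> > R" using assms by simp
  then obtain k where k: "\<bar>x + of_int k - y\<bar> \<le> R" "S_coh S c (y, x + of_int k) < S_coh S c (y, x)"
    using assms unfolding reach_def by blast
  have "S_coh S c (y + of_int (-k), x) = S_coh S c (y, x + of_int k)"
    using S_coh_int[of c "y + of_int (-k)" k x] by simp
  moreover have "\<bar>y + of_int (-k) - x\<bar> \<le> R" using k(1) by (simp add: abs_le_iff)
  ultimately show ?thesis using k that[of "y + of_int (-k)"] circle_fun_int[OF assms(3), of y "-k"] by simp
qed

lemma forward_maximizers_iff:
  "y \<in> forward_maximizers S c u x \<longleftrightarrow> (\<forall>y'. u y' - S_coh S c (x, y') \<le> u y - S_coh S c (x, y))"
  by (auto simp: forward_maximizers_def is_arg_max_def not_less)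

lemma forward_maximizer_near:
  assumes "reach C R" "\<bar>c\<bar> \<le> C" "circle_fun u" "y \<in> forward_maximizers S c u x"
  shows "\<bar>y - x\<bar> \<le> R"
proof (rule ccontr)
  assume "\<not> ?thesis"
  then obtain y' where "u y' = u y" "S_coh S c (x, y') < S_coh S c (x, y)"
    using reach_forward[OF assms(1-3), of y x] by auto
  moreover have "u y' - S_coh S c (x, y') \<le> u y - S_coh S c (x, y)"
    using assms(4) by (simp add: forward_maximizers_iff)
  ultimately show False by simp
qed

lemma forward_maximizers_nonempty:
  assumes u: "circle_fun u"
  shows "forward_maximizers S c u x \<noteq> {}"
proof -
  obtain R where R: "reach \<bar>c\<bar> R" using ex_reach by blast
  have "continuous_on {x - R..x + R} (\<lambda>y. u y - S_coh S c (x, y))"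
    by (intro continuous_intros continuous_on_compose2[OF continuous_S_coh[of UNIV]]
        continuous_on_subset[OF conjunct1[OF u[unfolded circle_fun_def]]]) auto
  moreover have "R \<ge> 1" using R by (simp add: reach_def)
  ultimately obtain y where y: "\<And>y'. y' \<in> {x - R..x + R} \<Longrightarrow> u y' - S_coh S c (x, y') \<le> u y - S_coh S c (x, y)"
    using continuous_attains_sup[of "{x - R..x + R}" "\<lambda>y. u y - S_coh S c (x, y)"] by fastforce
  have "u y' - S_coh S c (x, y') \<le> u y - S_coh S c (x, y)" for y'
  proof (cases "\<bar>y' - x\<bar> \<le> R")
    case False
    then obtain z where z: "\<bar>z - x\<bar> \<le> R" "u z = u y'" "S_coh S c (x, z) < S_coh S c (x, y')"
      using reach_forward[OF R _ u, of c y' x] by auto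
    then show ?thesis using y[of z] by (simp add: abs_le_iff)
  qed (use y[of y'] in \<open>simp add: abs_le_iff\<close>)
  then have "y \<in> forward_maximizers S c u x" by (simp add: forward_maximizers_iff)
  then show ?thesis by blast
qed

lemma backward_minimizer:
  assumes R: "reach C R" and c: "\<bar>c\<bar> \<le> C" and u: "circle_fun u"
  obtains y where "\<bar>y - x\<bar> \<le> R" "\<And>y'. u y + S_coh S c (y, x) \<le> u y' + S_coh S c (y', x)"
proof -
  have "continuous_on {x - R..x + R} (\<lambda>y. u y + S_coh S c (y, x))"
    by (intro continuous_intros continuous_on_compose2[OF continuous_S_coh[of UNIV]]
        continuous_on_subset[OF conjunct1[OF u[unfolded circle_fun_def]]]) auto
  moreover have "R \<ge> 1" using R by (simp add: reach_def)
  ultimately obtain y where y: "y \<in> {x - R..x + R}"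
    "\<And>y'. y' \<in> {x - R..x + R} \<Longrightarrow> u y + S_coh S c (y, x) \<le> u y' + S_coh S c (y', x)"
    using continuous_attains_inf[of "{x - R..x + R}" "\<lambda>y. u y + S_coh S c (y, x)"] by auto
  have "u y + S_coh S c (y, x) \<le> u y' + S_coh S c (y', x)" for y'
  proof (cases "\<bar>y' - x\<bar> \<le> R")
    case False
    then obtain z where z: "\<bar>z - x\<bar> \<le> R" "u z = u y'" "S_coh S c (z, x) < S_coh S c (y', x)"
      using reach_backward[OF R c u, of y' x] by auto
    then show ?thesis using y(2)[of z] by (simp add: abs_le_iff)
  qed (use y(2)[of y'] in \<open>simp add: abs_le_iff\<close>)
  with y(1) show ?thesis by (intro that[of y]) (auto simp: abs_le_iff)
qed

lemma T_minus_attained: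
  assumes "reach C R" "\<bar>c\<bar> \<le> C" "circle_fun u"
  obtains y where "\<bar>y - x\<bar> \<le> R" "T_minus S c u x = u y + S_coh S c (y, x)"
proof -
  obtain y where y: "\<bar>y - x\<bar> \<le> R" "\<And>y'. u y + S_coh S c (y, x) \<le> u y' + S_coh S c (y', x)"
    using backward_minimizer[OF assms] by blast
  then have "T_minus S c u x = u y + S_coh S c (y, x)"
    unfolding T_minus_def by (intro cInf_eq_minimum) auto
  with y(1) show ?thesis using that by blast
qed

lemma T_minus_le:
  assumes "circle_fun u"
  shows "T_minus S c u x \<le> u y + S_coh S c (y, x)"
proof -
  obtain R where R: "reach \<bar>c\<bar> R" using ex_reach by blast
  obtain z where "\<And>y'. u z + S_coh S c (z, x) \<le> u y' + S_coh S c (y', x)"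
    using backward_minimizer[OF R _ assms, of c x] by auto
  then show ?thesis
    unfolding T_minus_def by (intro cINF_lower bdd_belowI2[of _ "u z + S_coh S c (z, x)"]) auto
qed

lemma T_minus_mono:
  assumes "circle_fun u" "circle_fun v" "\<And>x. u x \<le> v x + a"
  shows "T_minus S c u x \<le> T_minus S c v x + a"
proof -
  obtain R where R: "reach \<bar>c\<bar> R" using ex_reach by blast
  obtain y where "T_minus S c v x = v y + S_coh S c (y, x)"
    using T_minus_attained[OF R _ assms(2), of c x] by auto
  then show ?thesis using T_minus_le[OF assms(1), of c x y] assms(3)[of y] by simp
qed

lemma T_minus_periodic:
  assumes u: "circle_fun u"
  shows "T_minus S c u (x + 1) = T_minus S c u x"
proof -
  have u1: "u (y + 1) = u y" for y using u by (simp add: circle_fun_def)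
  obtain R where R: "reach \<bar>c\<bar> R" using ex_reach by blast
  obtain y where "T_minus S c u x = u y + S_coh S c (y, x)"
    using T_minus_attained[OF R _ u, of c x] by auto
  then have "T_minus S c u (x + 1) \<le> T_minus S c u x"
    using T_minus_le[OF u, of c "x + 1" "y + 1"] by (simp add: u1 S_coh_periodic)
  moreover obtain z where "T_minus S c u (x + 1) = u z + S_coh S c (z, x + 1)"
    using T_minus_attained[OF R _ u, of c "x + 1"] by auto
  then have "T_minus S c u x \<le> T_minus S c u (x + 1)"
    using T_minus_le[OF u, of c x "z - 1"] u1[of "z - 1"] S_coh_periodic[of c "z - 1" x] by simp
  ultimately show ?thesis by simp
qed

lemma S_coh_lipschitz_on_strip:
  obtains L where "L \<ge> 0"
    "\<And>c x y y'. \<lbrakk>\<bar>c\<bar> \<le> C; \<bar>x - y\<bar> \<le> R; \<bar>y' - y\<bar> \<le> 1\<rbrakk> \<Longrightarrow>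
       \<bar>S_coh S c (x, y') - S_coh S c (x, y)\<bar> \<le> L * \<bar>y' - y\<bar>"
proof -
  obtain M where M: "M \<ge> 0" "\<And>x y. \<bar>x - y\<bar> \<le> R + 1 \<Longrightarrow> norm (partial2 S (x, y)) \<le> M"
    using diagonal_periodic_bounded_on_strip[OF continuous_partial2 partials_diagonal_periodic(2), of "R + 1"]
    by blast
  show ?thesis
  proof (rule that[of "M + \<bar>C\<bar>"])
    fix c x y y' :: real
    assume *: "\<bar>c\<bar> \<le> C" "\<bar>x - y\<bar> \<le> R" "\<bar>y' - y\<bar> \<le> 1"
    have "norm (S_coh S c (x, y') - S_coh S c (x, y)) \<le> (M + \<bar>C\<bar>) * norm (y' - y)"
    proof (rule field_differentiable_bound[of "{y-1..y+1}" _ "\<lambda>t. partial2 S (x, t) - c"])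
      fix t assume t: "t \<in> {y-1..y+1}"
      have "((\<lambda>t. S (x, t) + c * (x - t)) has_real_derivative partial2 S (x, t) - c) (at t)"
        by (auto intro!: derivative_eq_intros DERIV_S2)
      then show "((\<lambda>t. S_coh S c (x, t)) has_real_derivative partial2 S (x, t) - c) (at t within {y-1..y+1})"
        by (simp add: S_coh_eq has_field_derivative_at_within)
      have "\<bar>x - t\<bar> \<le> R + 1" using t * by (auto simp: abs_le_iff)
      from M(2)[OF this] show "norm (partial2 S (x, t) - c) \<le> M + \<bar>C\<bar>" using * by simp
    qed (use * in \<open>auto simp: abs_le_iff\<close>)
    then show "\<bar>S_coh S c (x, y') - S_coh S c (x, y)\<bar> \<le> (M + \<bar>C\<bar>) * \<bar>y' - y\<bar>" by simp
  qed (use M in auto)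
qed

text \<open>A minimizer at \<open>y\<close> is a competitor at \<open>x\<close>, so the oscillation of \<open>T_minus S c u\<close> is controlled by that
  of the action alone: the Lipschitz constant does not depend on \<open>u\<close>. All compactness below rests on
  this.\<close>

lemma T_minus_lipschitz:
  "\<exists>L. \<forall>c u x y. \<bar>c\<bar> \<le> C \<longrightarrow> circle_fun u \<longrightarrow> \<bar>T_minus S c u x - T_minus S c u y\<bar> \<le> L * \<bar>x - y\<bar>"
proof -
  obtain R where R: "reach C R" using ex_reach by blast
  obtain L where L: "L \<ge> 0" "\<And>c x y y'. \<lbrakk>\<bar>c\<bar> \<le> C; \<bar>x - y\<bar> \<le> R; \<bar>y' - y\<bar> \<le> 1\<rbrakk> \<Longrightarrow>
       \<bar>S_coh S c (x, y') - S_coh S c (x, y)\<bar> \<le> L * \<bar>y' - y\<bar>"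
    using S_coh_lipschitz_on_strip[of C R] by blast
  show ?thesis
  proof (intro exI allI impI)
    fix c u x y assume c: "\<bar>c\<bar> \<le> C" and u: "circle_fun u"
    have half: "T_minus S c u x - T_minus S c u y \<le> L * \<bar>x - y\<bar>" if xy: "\<bar>x - y\<bar> \<le> 1" for x y
    proof -
      obtain z where z: "\<bar>z - y\<bar> \<le> R" "T_minus S c u y = u z + S_coh S c (z, y)"
        using T_minus_attained[OF R c u] by blast
      show ?thesis using T_minus_le[OF u, of c x z] L(2)[OF c z(1) xy] z(2) by linarith
    qed
    have "\<bar>T_minus S c u x - T_minus S c u y\<bar> \<le> L * \<bar>x - y\<bar>" if "\<bar>x - y\<bar> \<le> 1" for x y
      using half[of x y] half[of y x] that by (simp add: abs_le_iff abs_minus_commute)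
    from periodic_locally_lipschitz[OF T_minus_periodic[OF u] L(1) this]
    show "\<bar>T_minus S c u x - T_minus S c u y\<bar> \<le> L * \<bar>x - y\<bar>" .
  qed
qed

lemma circle_fun_T_minus:
  assumes "circle_fun u"
  shows "circle_fun (T_minus S c u)"
proof -
  obtain L where "\<forall>c' u x y. \<bar>c'\<bar> \<le> \<bar>c\<bar> \<longrightarrow> circle_fun u \<longrightarrow>
    \<bar>T_minus S c' u x - T_minus S c' u y\<bar> \<le> L * \<bar>x - y\<bar>"
    using T_minus_lipschitz[of "\<bar>c\<bar>"] ..
  then have "\<bar>T_minus S c u x - T_minus S c u y\<bar> \<le> L * \<bar>x - y\<bar>" for x y
    using assms by simp
  then show ?thesis by (rule circle_fun_lipschitz) (rule T_minus_periodic[OF assms])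
qed

text \<open>Minimizers lie within a common distance \<open>R\<close> of \<open>x\<close>, where the functions being minimized converge
  uniformly, and uniform convergence passes to minima.\<close>

lemma T_minus_uniform_limit:
  assumes cn: "cs \<longlonglongrightarrow> c" and bn: "\<And>n. circle_fun (b n)" and b: "circle_fun b'"
    and lim: "uniform_limit UNIV b b' sequentially"
  shows "(\<lambda>n. T_minus S (cs n) (b n) x) \<longlonglongrightarrow> T_minus S c b' x"
proof -
  obtain C0 where C0: "\<And>n. \<bar>cs n\<bar> \<le> C0"
    using convergent_imp_Bseq[of cs] cn by (auto simp: convergent_def Bseq_def)
  define C where "C = max C0 \<bar>c\<bar>"
  have csC: "\<bar>cs n\<bar> \<le> C" for n using C0[of n] by (simp add: C_def)
  have cC: "\<bar>c\<bar> \<le> C" by (simp add: C_def)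
  obtain R where R: "reach C R" using ex_reach by blast
  then have R1: "R \<ge> 1" by (simp add: reach_def)
  show ?thesis
  proof (rule LIMSEQ_I)
    fix r :: real assume r: "r > 0"
    have "\<forall>\<^sub>F n in sequentially. \<forall>x\<in>UNIV. dist (b n x) (b' x) < r / 3"
      using uniform_limitD[OF lim, of "r / 3"] r by simp
    moreover have "\<forall>\<^sub>F n in sequentially. dist (cs n) c < r / (3 * R)"
      using cn r R1 by (intro tendstoD) auto
    ultimately have "\<forall>\<^sub>F n in sequentially. norm (T_minus S (cs n) (b n) x - T_minus S c b' x) < r"
    proof eventually_elim
      case (elim n)
      have close: "\<bar>(b n y + S_coh S (cs n) (y, x)) - (b' y + S_coh S c (y, x))\<bar> < r"
        if y: "\<bar>y - x\<bar> \<le> R" for y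
      proof -
        have "\<bar>cs n - c\<bar> * \<bar>y - x\<bar> \<le> r / (3 * R) * R"
          using elim(2) y r R1 by (intro mult_mono) (auto simp: dist_real_def)
        then have "\<bar>(cs n - c) * (y - x)\<bar> \<le> r / 3" using R1 by (simp add: abs_mult)
        moreover have "\<bar>b n y - b' y\<bar> < r / 3" using elim(1) by (simp add: dist_real_def)
        moreover have "(b n y + S_coh S (cs n) (y, x)) - (b' y + S_coh S c (y, x))
            = (b n y - b' y) + (cs n - c) * (y - x)"
          by (simp add: S_coh_eq algebra_simps)
        ultimately show ?thesis using r by linarith
      qed
      obtain y where y: "\<bar>y - x\<bar> \<le> R" "T_minus S (cs n) (b n) x = b n y + S_coh S (cs n) (y, x)"
        using T_minus_attained[OF R csC bn] by blast
      obtain z where z: "\<bar>z - x\<bar> \<le> R" "T_minus S c b' x = b' z + S_coh S c (z, x)"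
        using T_minus_attained[OF R cC b] by blast
      show ?case
        using close[OF y(1)] close[OF z(1)] y(2) z(2) T_minus_le[OF bn[of n], of "cs n" x z] T_minus_le[OF b, of c x y]
        by (simp add: abs_less_iff)
    qed
    then show "\<exists>no. \<forall>n\<ge>no. norm (T_minus S (cs n) (b n) x - T_minus S c b' x) < r"
      by (simp add: eventually_sequentially)
  qed
qed

section \<open>Existence of weak K.A.M. solutions\<close>

text \<open>This is the weak K.A.M. equation with the infimum resolved: the second condition says that the
  constant is a lower bound and the third that it is attained, so that the infimum operator
  disappears from the proofs about solutions.\<close>

definition calibrated :: "real \<Rightarrow> real \<Rightarrow> (real \<Rightarrow> real) \<Rightarrow> bool" where
  "calibrated c s u \<longleftrightarrow> circle_fun u \<and> (\<forall>x y. u x + s \<le> u y + S_coh S c (y, x)) \<and>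
     (\<forall>x. \<exists>y. u x + s = u y + S_coh S c (y, x))"

lemma weak_KAM_eq_iff_calibrated: "weak_KAM_eq S c s u \<longleftrightarrow> calibrated c s u"
proof
  assume *: "weak_KAM_eq S c s u"
  then have u: "circle_fun u" and T: "\<And>x. u x + s = T_minus S c u x"
    by (auto simp: weak_KAM_eq_def circle_fun_def algebra_simps)
  obtain R where R: "reach \<bar>c\<bar> R" using ex_reach by blast
  show "calibrated c s u"
    unfolding calibrated_def T
    using u T_minus_le[OF u] T_minus_attained[OF R _ u, of c] by (metis order_refl)
next
  assume *: "calibrated c s u"
  then have u: "circle_fun u" by (simp add: calibrated_def)
  have "T_minus S c u x = u x + s" for x
  proof -
    obtain y where "u x + s = u y + S_coh S c (y, x)" using * unfolding calibrated_def by blast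
    then show ?thesis
      unfolding T_minus_def using * by (intro cInf_eq_minimum) (auto simp: calibrated_def, metis)
  qed
  then show "weak_KAM_eq S c s u" using u by (simp add: weak_KAM_eq_def circle_fun_def)
qed

lemma calibratedI:
  assumes "circle_fun u" "\<And>x. T_minus S c u x = u x + s"
  shows "calibrated c s u"
  using assms by (simp add: weak_KAM_eq_iff_calibrated[symmetric] weak_KAM_eq_def circle_fun_def)

lemma calibrated_T_minus: "calibrated c s u \<Longrightarrow> T_minus S c u x = u x + s"
  by (simp add: weak_KAM_eq_iff_calibrated[symmetric] weak_KAM_eq_def)

text \<open>At a minimum point \<open>x\<close> of \<open>u - u'\<close>, a predecessor of \<open>x\<close> for \<open>u\<close> can be inserted into the inequality for
  \<open>u'\<close>, which gives \<open>s' \<le> s\<close>.\<close>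

lemma calibrated_constant_unique:
  assumes "calibrated c s u" "calibrated c s' u'"
  shows "s = s'"
proof -
  have le: "s' \<le> s" if us: "calibrated c s u" "calibrated c s' u'" for s s' u u'
  proof -
    have cf: "circle_fun u" "circle_fun u'" using us by (auto simp: calibrated_def)
    have "continuous_on {0..1} (\<lambda>x. u x - u' x)"
      using cf by (auto intro!: continuous_intros intro: continuous_on_subset simp: circle_fun_def)
    then obtain x where x: "\<And>y. y \<in> {0..1} \<Longrightarrow> u x - u' x \<le> u y - u' y"
      using continuous_attains_inf[of "{0..1}" "\<lambda>x. u x - u' x"] by fastforce
    obtain y where y: "u x + s = u y + S_coh S c (y, x)" using us unfolding calibrated_def by blast
    have fr: "w (frac y) = w y" if "circle_fun w" for w
      using circle_fun_int[OF that, of y "-\<lfloor>y\<rfloor>"] by (simp add: frac_def)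
    have "u x - u' x \<le> u y - u' y"
      using x[of "frac y"] unfolding fr[OF cf(1)] fr[OF cf(2)] by (simp add: less_imp_le[OF frac_lt_1])
    moreover have "u' x + s' \<le> u' y + S_coh S c (y, x)" using us by (auto simp: calibrated_def)
    ultimately show ?thesis using y by simp
  qed
  from le[OF assms] le[OF assms(2,1)] show ?thesis by simp
qed

lemma T_minus_funpow:
  assumes "circle_fun u"
  shows "circle_fun ((T_minus S c ^^ n) u)"
  using assms by (induction n) (auto intro: circle_fun_T_minus)

lemma T_minus_funpow_mono:
  assumes "circle_fun u" "circle_fun v" "\<And>x. u x \<le> v x + a"
  shows "(T_minus S c ^^ n) u x \<le> (T_minus S c ^^ n) v x + a"
  using assms(3)
proof (induction n arbitrary: x)
  case (Suc n)
  then show ?case using T_minus_mono T_minus_funpow assms(1,2) by simp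
qed simp

text \<open>The values at \<open>0\<close> of the iterates \<open>a n\<close> of the zero function grow linearly up to a bounded error;
  their rate is the constant \<open>s\<close>. The infimum \<open>v0\<close> of the bounded functions \<open>w n = a n - n s\<close> is a
  subsolution, because applying the operator merely shifts the index. The normalized iterates of a
  subsolution increase, are bounded and equi-Lipschitz, and so converge to a solution.\<close>

lemma ex_calibrated: "\<exists>s u. calibrated c s u"
proof -
  let ?T = "T_minus S c"
  obtain L where "\<forall>c' u x y. \<bar>c'\<bar> \<le> \<bar>c\<bar> \<longrightarrow> circle_fun u \<longrightarrow>
    \<bar>T_minus S c' u x - T_minus S c' u y\<bar> \<le> L * \<bar>x - y\<bar>"
    using T_minus_lipschitz[of "\<bar>c\<bar>"] ..
  then have L: "\<bar>?T u x - ?T u y\<bar> \<le> L * \<bar>x - y\<bar>" if "circle_fun u" for u x y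
    using that by simp
  have zero: "circle_fun (\<lambda>_. 0)" by (simp add: circle_fun_def)
  have L0: "L \<ge> 0" using L[OF zero, of 0 1] by simp
  define a where "a n = (?T ^^ n) (\<lambda>_. 0)" for n
  have a_fun: "circle_fun (a n)" for n unfolding a_def by (intro T_minus_funpow zero)
  have a_lip: "\<bar>a n x - a n y\<bar> \<le> L * \<bar>x - y\<bar>" for n x y
    using L[OF a_fun] L0 by (cases n) (auto simp: a_def)
  have a_osc: "\<bar>a n x - a n 0\<bar> \<le> L" for n x
    using periodic_lipschitz_oscillation[of "a n" L] a_lip a_fun by (auto simp: circle_fun_def)
  have "\<bar>a (m + n) 0 - a m 0 - a n 0\<bar> \<le> L" for m n
  proof -
    have "a (m + n) = (?T ^^ m) (a n)" by (simp add: a_def funpow_add)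
    moreover have "(?T ^^ m) (a n) 0 \<le> a m 0 + (a n 0 + L)"
      unfolding a_def[of m] using a_osc[of n]
      by (intro T_minus_funpow_mono a_fun zero) (simp add: abs_le_iff algebra_simps)
    moreover have "a m 0 \<le> (?T ^^ m) (a n) 0 + (L - a n 0)"
      unfolding a_def[of m] using a_osc[of n]
      by (intro T_minus_funpow_mono a_fun zero) (simp add: abs_le_iff algebra_simps)
    ultimately show ?thesis by (simp add: abs_le_iff)
  qed
  then obtain s where s: "\<And>n. \<bar>a n 0 - real n * s\<bar> \<le> L"
    using almost_additive_rate[of "\<lambda>n. a n 0" L] by blast
  define w where "w n x = a n x - real n * s" for n x
  have w_bdd: "\<bar>w n x\<bar> \<le> 2 * L" for n x
    using s[of n] a_osc[of n x] by (simp add: w_def)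
  have w_step: "w (Suc n) x + s \<le> w n y + S_coh S c (y, x)" for n x y
    using T_minus_le[OF a_fun[of n], of c x y] by (simp add: w_def a_def algebra_simps)
  define v0 where "v0 x = (INF n. w n x)" for x
  have w_below: "bdd_below (range (\<lambda>n. w n x))" for x
    by (rule bdd_belowI2[of _ "-2 * L"]) (use w_bdd[of _ x] in \<open>simp add: abs_le_iff, smt (verit)\<close>)
  have v0_le: "v0 x \<le> w n x" for n x unfolding v0_def by (rule cINF_lower[OF w_below]) simp
  have v0_ge: "v0 x \<ge> r" if "\<And>n. r \<le> w n x" for r x unfolding v0_def by (rule cINF_greatest) (use that in auto)
  have v0_lip: "\<bar>v0 x - v0 y\<bar> \<le> L * \<bar>x - y\<bar>" for x y
  proof -
    have "v0 x \<ge> v0 y - L * \<bar>x - y\<bar>" for x y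
      by (rule v0_ge) (use v0_le[of y] a_lip[of _ x y] in \<open>simp add: w_def, smt (verit)\<close>)
    from this[of x y] this[of y x] show ?thesis by (simp add: abs_le_iff abs_minus_commute)
  qed
  have v0_fun: "circle_fun v0"
  proof (rule circle_fun_lipschitz[OF v0_lip])
    show "v0 (x + 1) = v0 x" for x using a_fun by (simp add: v0_def w_def circle_fun_def)
  qed
  have v0_sub: "v0 x + s \<le> ?T v0 x" for x
  proof -
    obtain R where R: "reach \<bar>c\<bar> R" using ex_reach by blast
    obtain y where y: "?T v0 x = v0 y + S_coh S c (y, x)"
      using T_minus_attained[OF R _ v0_fun, of c x] by auto
    have "v0 x + s - S_coh S c (y, x) \<le> v0 y"
    proof (rule v0_ge)
      show "v0 x + s - S_coh S c (y, x) \<le> w n y" for n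
        using v0_le[of x "Suc n"] w_step[of n x y] by simp
    qed
    then show ?thesis using y by simp
  qed
  define v where "v n x = (?T ^^ n) v0 x - real n * s" for n x
  have Tv: "?T (v n) x = v (Suc n) x + s" for n x
  proof -
    have f: "circle_fun ((?T ^^ n) v0)" "circle_fun (v n)"
      using T_minus_funpow[OF v0_fun, of n c] by (auto simp: v_def circle_fun_def intro!: continuous_intros)
    have "?T (v n) x \<le> ?T ((?T ^^ n) v0) x + (- real n * s)"
      by (rule T_minus_mono[OF f(2,1)]) (simp add: v_def)
    moreover have "?T ((?T ^^ n) v0) x \<le> ?T (v n) x + real n * s"
      by (rule T_minus_mono[OF f]) (simp add: v_def)
    ultimately show ?thesis by (simp add: v_def algebra_simps)
  qed
  have v_lip: "\<bar>v n x - v n y\<bar> \<le> L * \<bar>x - y\<bar>" for n x y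
    using L[OF T_minus_funpow[OF v0_fun]] v0_lip by (cases n) (auto simp: v_def)
  have v_per: "v n (x + 1) = v n x" for n x
    using T_minus_funpow[OF v0_fun, of n c] by (simp add: v_def circle_fun_def)
  have v_fun: "circle_fun (v n)" for n by (rule circle_fun_lipschitz[OF v_lip v_per])
  \<comment> \<open>Monotonicity of the operator propagates the subsolution inequality \<open>v0 + s \<le> T v0\<close>.\<close>
  have v_inc: "v n x \<le> v (Suc n) x" for n x
  proof (induction n arbitrary: x)
    case 0
    then show ?case using v0_sub[of x] by (simp add: v_def)
  next
    case (Suc n)
    have "?T (v n) x \<le> ?T (v (Suc n)) x + 0" by (rule T_minus_mono[OF v_fun v_fun]) (use Suc in simp)
    then show ?case by (simp add: Tv)
  qed
  have inc: "incseq (\<lambda>n. v n x)" for x using v_inc by (intro incseq_SucI)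
  have v_upper: "v n x \<le> 2 * L" for n x
  proof -
    have "(?T ^^ n) v0 x \<le> a n x + 0"
      unfolding a_def by (rule T_minus_funpow_mono[OF v0_fun zero]) (use v0_le[of _ 0] in \<open>simp add: w_def a_def\<close>)
    then show ?thesis using w_bdd[of n x] by (simp add: v_def w_def)
  qed
  have v_lower: "v n x \<ge> - (2 * L)" for n x
  proof -
    have "v 0 x \<le> v n x" using inc[of x] by (simp add: incseq_def)
    moreover have "v0 x \<ge> - (2 * L)" by (rule v0_ge) (use w_bdd[of _ x] in \<open>simp add: abs_le_iff, smt (verit)\<close>)
    ultimately show ?thesis by (simp add: v_def)
  qed
  have "\<bar>v n 0\<bar> \<le> 2 * L" for n using v_upper[of n 0] v_lower[of n 0] by (simp add: abs_le_iff)
  then obtain u r where r: "strict_mono (r :: nat \<Rightarrow> nat)" "uniform_limit UNIV (\<lambda>n. v (r n)) u sequentially"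
    and u: "continuous_on UNIV u" "\<And>x. u (x + 1) = u x"
    using periodic_Arzela_Ascoli[of v L, OF v_per v_lip] by blast
  have uf: "circle_fun u" using u by (simp add: circle_fun_def)
  have "?T u x = u x + s" for x
  proof -
    have "(\<lambda>n. v (r n) x) \<longlonglongrightarrow> u x" using tendsto_uniform_limitI[OF r(2)] by simp
    moreover obtain l where l: "(\<lambda>n. v n x) \<longlonglongrightarrow> l"
      using incseq_convergent[OF inc] v_upper by blast
    moreover have "(\<lambda>n. v (r n) x) \<longlonglongrightarrow> l"
      using LIMSEQ_subseq_LIMSEQ[OF l r(1)] by (simp add: o_def)
    \<comment> \<open>A monotone sequence converges as a whole, so the limits along \<open>r n\<close> and along
      \<open>Suc (r n)\<close> agree and \<open>u\<close> is a fixed point.\<close>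
    ultimately have "(\<lambda>n. v n x) \<longlonglongrightarrow> u x" using LIMSEQ_unique by blast
    then have "(\<lambda>n. v (Suc n) x) \<longlonglongrightarrow> u x" by (rule LIMSEQ_Suc)
    from LIMSEQ_subseq_LIMSEQ[OF this r(1)]
    have "(\<lambda>n. v (Suc (r n)) x + s) \<longlonglongrightarrow> u x + s" by (auto simp: o_def intro!: tendsto_intros)
    then have "(\<lambda>n. ?T (v (r n)) x) \<longlonglongrightarrow> u x + s" by (simp add: Tv)
    moreover have "(\<lambda>n. ?T (v (r n)) x) \<longlonglongrightarrow> ?T u x"
      by (rule T_minus_uniform_limit[OF tendsto_const v_fun uf r(2)])
    ultimately show ?thesis using LIMSEQ_unique by blast
  qed
  then show ?thesis using calibratedI[OF uf] by blast
qed

lemma S_bar_eq: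
  assumes "calibrated c s u"
  shows "S_bar S c = s"
  unfolding S_bar_def weak_KAM_eq_iff_calibrated
  using assms calibrated_constant_unique by (intro the_equality) blast+

lemma calibrated_S_bar: "\<exists>u. calibrated c (S_bar S c) u"
  using ex_calibrated[of c] S_bar_eq by blast

section \<open>The optimal forward map\<close>

lemma DERIV_S_coh1: "((\<lambda>t. S_coh S c (t, y)) has_real_derivative partial1 S (x, y) + c) (at x)"
  unfolding S_coh_eq by (auto intro!: derivative_eq_intros DERIV_S1)

lemma DERIV_S_coh2: "((\<lambda>t. S_coh S c (x, t)) has_real_derivative partial2 S (x, y) - c) (at y)"
  unfolding S_coh_eq by (auto intro!: derivative_eq_intros DERIV_S2)

lemma calibrated_circle_fun: "calibrated c s u \<Longrightarrow> circle_fun u"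
  by (simp add: calibrated_def)

lemma calibrated_le: "calibrated c s u \<Longrightarrow> u x + s \<le> u y + S_coh S c (y, x)"
  by (simp add: calibrated_def)

lemma calibrated_predecessor:
  assumes "calibrated c s u"
  obtains y where "u x + s = u y + S_coh S c (y, x)"
  using assms unfolding calibrated_def by blast

text \<open>Exchanging two maximizers in the wrong order would lower the total action, by the twist inequality.\<close>

lemma forward_maximizers_mono:
  assumes "x1 < x2" and y1: "y1 \<in> forward_maximizers S c u x1" and y2: "y2 \<in> forward_maximizers S c u x2"
  shows "y1 \<le> y2"
proof (rule ccontr)
  assume "\<not> y1 \<le> y2"
  then have "0 < e * (x2 - x1) * (y1 - y2)" using assms(1) e_pos by simp
  moreover have "u y2 - S_coh S c (x1, y2) \<le> u y1 - S_coh S c (x1, y1)"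
    "u y1 - S_coh S c (x2, y1) \<le> u y2 - S_coh S c (x2, y2)"
    using y1 y2 by (auto simp: forward_maximizers_iff)
  moreover have "S (x1, y2) + S (x2, y1) + e * (x2 - x1) * (y1 - y2) \<le> S (x1, y1) + S (x2, y2)"
    using \<open>\<not> y1 \<le> y2\<close> assms(1) by (intro twist_inequality) auto
  ultimately show False by (simp add: S_coh_eq algebra_simps)
qed

text \<open>This is the link between the backward equation satisfied by \<open>u\<close> and the forward problem: the inverse
  of the forward map contains the predecessor relation, which is defined at every point.\<close>

lemma predecessor_maximizer:
  assumes "calibrated c s u" "u x + s = u y + S_coh S c (y, x)"
  shows "x \<in> forward_maximizers S c u y"
  unfolding forward_maximizers_iff
proof
  fix y' show "u y' - S_coh S c (y, y') \<le> u x - S_coh S c (y, x)"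
    using calibrated_le[OF assms(1), of y' y] assms(2) by simp
qed

text \<open>At \<open>z\<close> the solution is touched from above by the smooth function \<open>u v + S_coh S c (v, \<cdot>) - s\<close>.\<close>

lemma calibrated_derivative_from_predecessor:
  assumes u: "calibrated c s u" and v: "u z + s = u v + S_coh S c (v, z)"
    and a: "(u has_real_derivative a) (at z)"
  shows "a = partial2 S (v, z) - c"
proof (rule derivative_eq_if_touching[OF a])
  show "((\<lambda>t. u v + S_coh S c (v, t) - s) has_real_derivative partial2 S (v, z) - c) (at z)"
    by (auto intro!: derivative_eq_intros DERIV_S_coh2)
qed (use calibrated_le[OF u, of _ v] v in \<open>auto simp: algebra_simps\<close>)

text \<open>Touching functions: \<open>v\<close> provides a smooth one above \<open>u\<close>, and \<open>w\<close> a smooth one below.\<close>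

lemma calibrated_interior_derivative:
  assumes u: "calibrated c s u" and v: "u z + s = u v + S_coh S c (v, z)"
    and w: "u w + s = u z + S_coh S c (z, w)"
  shows "(u has_real_derivative - partial1 S (z, w) - c) (at z)"
proof (rule derivative_squeeze)
  show "((\<lambda>t. u w + s - S_coh S c (t, w)) has_real_derivative - partial1 S (z, w) - c) (at z)"
    by (auto intro!: derivative_eq_intros DERIV_S_coh1)
  show "((\<lambda>t. u v + S_coh S c (v, t) - s) has_real_derivative partial2 S (v, z) - c) (at z)"
    by (auto intro!: derivative_eq_intros DERIV_S_coh2)
  show "u w + s - S_coh S c (t, w) \<le> u t" for t
    using calibrated_le[OF u, of w t] by simp
  show "u t \<le> u v + S_coh S c (v, t) - s" for t
    using calibrated_le[OF u, of t v] by simp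
qed (use v w in auto)

text \<open>Between two maximizers at \<open>x\<close> the predecessor of every point is \<open>x\<close>, by monotonicity. Then \<open>u\<close> would
  have two different derivatives at \<open>x\<close>.\<close>

lemma forward_maximizers_unique:
  assumes u: "calibrated c s u"
    and y: "y \<in> forward_maximizers S c u x" "y' \<in> forward_maximizers S c u x"
  shows "y = y'"
proof -
  have no_gap: False if yy: "y \<in> forward_maximizers S c u x" "y' \<in> forward_maximizers S c u x" "y < y'" for y y'
  proof -
    have pre: "u w + s = u x + S_coh S c (x, w)" if w: "y < w" "w < y'" for w
    proof -
      obtain z where z: "u w + s = u z + S_coh S c (z, w)" using calibrated_predecessor[OF u] by blast
      have wz: "w \<in> forward_maximizers S c u z" using predecessor_maximizer[OF u z] .
      have "\<not> z < x" using forward_maximizers_mono[OF _ wz yy(1)] w by auto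
      moreover have "\<not> x < z" using forward_maximizers_mono[OF _ yy(2) wz] w by auto
      ultimately show ?thesis using z by simp
    qed
    obtain v where v: "u x + s = u v + S_coh S c (v, x)" using calibrated_predecessor[OF u] by blast
    \<comment> \<open>Any two distinct points strictly between \<open>y\<close> and \<open>y'\<close> will do.\<close>
    let ?w1 = "(2 * y + y') / 3" and ?w2 = "(y + 2 * y') / 3"
    have w: "y < ?w1" "?w1 < ?w2" "?w2 < y'" using yy(3) by auto
    have "- partial1 S (x, ?w1) - c = - partial1 S (x, ?w2) - c"
      using calibrated_interior_derivative[OF u v pre[of ?w1]]
        calibrated_interior_derivative[OF u v pre[of ?w2]] w by (intro DERIV_unique) auto
    moreover have "partial1 S (x, ?w2) \<le> partial1 S (x, ?w1) - e * (?w2 - ?w1)"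
      using w by (intro partial1_decreasing) auto
    moreover have "e * (?w2 - ?w1) > 0" using w(2) e_pos by (intro mult_pos_pos) auto
    ultimately show False by linarith
  qed
  from no_gap[OF y] no_gap[OF y(2,1)] show ?thesis by (cases y y' rule: linorder_cases) auto
qed

definition optimal_forward :: "real \<Rightarrow> (real \<Rightarrow> real) \<Rightarrow> real \<Rightarrow> real" where
  "optimal_forward c u x = (THE y. y \<in> forward_maximizers S c u x)"

lemma forward_maximizers_eq:
  assumes u: "calibrated c s u"
  shows "forward_maximizers S c u x = {optimal_forward c u x}"
proof -
  obtain y where y: "y \<in> forward_maximizers S c u x"
    using forward_maximizers_nonempty[OF calibrated_circle_fun[OF u]] by blast
  then have "optimal_forward c u x = y"
    unfolding optimal_forward_def using forward_maximizers_unique[OF u] by blast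
  then show ?thesis using y forward_maximizers_unique[OF u] by blast
qed

lemma optimal_forward_eqI:
  assumes "calibrated c s u" "y \<in> forward_maximizers S c u x"
  shows "optimal_forward c u x = y"
  using forward_maximizers_eq[OF assms(1)] assms(2) by auto

lemma optimal_forward_of_predecessor:
  assumes "calibrated c s u" "u x + s = u y + S_coh S c (y, x)"
  shows "optimal_forward c u y = x"
  using optimal_forward_eqI[OF assms(1) predecessor_maximizer[OF assms]] .

lemma optimal_forward_translate:
  assumes u: "calibrated c s u"
  shows "optimal_forward c u (x + 1) = optimal_forward c u x + 1"
proof (rule optimal_forward_eqI[OF u])
  let ?y = "optimal_forward c u x"
  have per: "u (y + 1) = u y" for y using calibrated_circle_fun[OF u] by (simp add: circle_fun_def)
  have y: "\<And>y'. u y' - S_coh S c (x, y') \<le> u ?y - S_coh S c (x, ?y)"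
    using forward_maximizers_eq[OF u, of x] forward_maximizers_iff by blast
  show "?y + 1 \<in> forward_maximizers S c u (x + 1)"
    unfolding forward_maximizers_iff
  proof
    fix y' show "u y' - S_coh S c (x + 1, y') \<le> u (?y + 1) - S_coh S c (x + 1, ?y + 1)"
      using y[of "y' - 1"] per[of "y' - 1"] S_coh_periodic[of c x "y' - 1"]
      by (simp add: per S_coh_periodic)
  qed
qed

lemma optimal_forward_mono:
  assumes u: "calibrated c s u"
  shows "mono (optimal_forward c u)"
proof (rule monoI)
  fix x y :: real assume "x \<le> y"
  then show "optimal_forward c u x \<le> optimal_forward c u y"
    using forward_maximizers_mono[of x y _ c u] forward_maximizers_eq[OF u] by (cases "x = y") auto
qed

text \<open>At a point of differentiability \<open>u\<close> lies below its tangent line plus a quadratic term, since it is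
  touched from above by \<open>S_coh S c (v, \<cdot>)\<close> plus a constant, with second derivative bounded for \<open>v\<close> within reach. Adding the
  two estimates, at \<open>z1\<close> evaluated in \<open>z2\<close> and conversely, gives a one-sided Lipschitz bound for the
  derivative. It is stated only at points of differentiability, where the Lipschitz estimate for the
  forward map needs it.\<close>

lemma calibrated_semiconcave:
  assumes u: "calibrated c s u"
  obtains K where "K \<ge> 0"
    "\<And>z1 z2 a1 a2. \<lbrakk>z1 \<le> z2; z2 \<le> z1 + 1; (u has_real_derivative a1) (at z1);
       (u has_real_derivative a2) (at z2)\<rbrakk> \<Longrightarrow> a2 - a1 \<le> K * (z2 - z1)"
proof -
  obtain R where R: "reach \<bar>c\<bar> R" using ex_reach by blast
  obtain K where K: "K \<ge> 0" "\<And>x y x' y'. \<lbrakk>\<bar>x - y\<bar> \<le> R; \<bar>x' - x\<bar> \<le> 1; \<bar>y' - y\<bar> \<le> 1\<rbrakk> \<Longrightarrow>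
       \<bar>partial2 S (x', y') - partial2 S (x, y)\<bar> \<le> K * (\<bar>x' - x\<bar> + \<bar>y' - y\<bar>)"
    by (rule partials_lipschitz_on_strip[of R]) blast
  show ?thesis
  proof (rule that[of "2 * K"])
    fix z1 z2 a1 a2 assume z: "z1 \<le> z2" "z2 \<le> z1 + 1"
      and a1: "(u has_real_derivative a1) (at z1)" and a2: "(u has_real_derivative a2) (at z2)"
    show "a2 - a1 \<le> 2 * K * (z2 - z1)"
    proof (cases "z1 = z2")
      case True
      then show ?thesis using DERIV_unique[OF a1] a2 by simp
    next
      case False
      define d where "d = z2 - z1"
      have d: "0 < d" "d \<le> 1" using z False by (auto simp: d_def)
      have pre: "\<exists>v. \<bar>v - z\<bar> \<le> R \<and> u z + s = u v + S_coh S c (v, z) \<and> a = partial2 S (v, z) - c"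
        if a: "(u has_real_derivative a) (at z)" for z a
      proof -
        obtain v where v: "u z + s = u v + S_coh S c (v, z)" using calibrated_predecessor[OF u] by blast
        have "\<bar>z - v\<bar> \<le> R"
          using forward_maximizer_near[OF R _ calibrated_circle_fun[OF u] predecessor_maximizer[OF u v]] by simp
        then show ?thesis
          using v calibrated_derivative_from_predecessor[OF u v a] by (auto simp: abs_minus_commute)
      qed
      obtain v1 where v1: "\<bar>v1 - z1\<bar> \<le> R" "u z1 + s = u v1 + S_coh S c (v1, z1)" "a1 = partial2 S (v1, z1) - c"
        using pre[OF a1] by blast
      obtain v2 where v2: "\<bar>v2 - z2\<bar> \<le> R" "u z2 + s = u v2 + S_coh S c (v2, z2)" "a2 = partial2 S (v2, z2) - c"
        using pre[OF a2] by blast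
      have "z1 < z2" using d by (simp add: d_def)
      obtain t1 where t1: "z1 < t1" "t1 < z2"
        "S_coh S c (v1, z2) - S_coh S c (v1, z1) = (z2 - z1) * (partial2 S (v1, t1) - c)"
        using MVT2[OF \<open>z1 < z2\<close> DERIV_S_coh2] by blast
      obtain t2 where t2: "z1 < t2" "t2 < z2"
        "S_coh S c (v2, z2) - S_coh S c (v2, z1) = (z2 - z1) * (partial2 S (v2, t2) - c)"
        using MVT2[OF \<open>z1 < z2\<close> DERIV_S_coh2] by blast
      have "\<bar>partial2 S (v1, t1) - partial2 S (v1, z1)\<bar> \<le> K * (\<bar>v1 - v1\<bar> + \<bar>t1 - z1\<bar>)"
        using v1(1) t1(1,2) d by (intro K(2)) (auto simp: d_def)
      also have "\<dots> \<le> K * d" using t1(1,2) K(1) by (intro mult_left_mono) (auto simp: d_def)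
      finally have b1: "partial2 S (v1, t1) - c \<le> a1 + K * d" using v1(3) by linarith
      have "\<bar>partial2 S (v2, t2) - partial2 S (v2, z2)\<bar> \<le> K * (\<bar>v2 - v2\<bar> + \<bar>t2 - z2\<bar>)"
        using v2(1) t2(1,2) d by (intro K(2)) (auto simp: d_def)
      also have "\<dots> \<le> K * d" using t2(1,2) K(1) by (intro mult_left_mono) (auto simp: d_def)
      finally have b2: "a2 - K * d \<le> partial2 S (v2, t2) - c" using v2(3) by linarith
      have "d * (a2 - K * d) \<le> d * (partial2 S (v2, t2) - c)"
        using b2 d by (intro mult_left_mono) auto
      also have "\<dots> \<le> u z2 - u z1"
        using calibrated_le[OF u, of z1 v2] v2(2) t2(3) by (simp add: d_def)
      also have "\<dots> \<le> d * (partial2 S (v1, t1) - c)"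
        using calibrated_le[OF u, of z2 v1] v1(2) t1(3) by (simp add: d_def)
      also have "\<dots> \<le> d * (a1 + K * d)"
        using b1 d by (intro mult_left_mono) auto
      finally have "a2 - K * d \<le> a1 + K * d" using d by simp
      then show ?thesis by (simp add: d_def algebra_simps)
    qed
  qed (use K in simp)
qed

text \<open>The predecessor relation inverts the forward map, so the bound amounts to an expansion estimate for
  predecessors: if \<open>z1\<close> and \<open>z2\<close> are predecessors of \<open>w1 \<le> w2\<close>, then \<open>w2 - w1\<close> is at most a multiple
  of \<open>z2 - z1\<close>. There \<open>u\<close> has the derivatives \<open>- partial1 S (z, w) - c\<close>, whose growth in \<open>w\<close> is
  at least \<open>e\<close> by the twist and whose growth along the points \<open>z\<close> is bounded by semiconcavity.\<close>

lemma optimal_forward_lipschitz: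
  assumes u: "calibrated c s u"
  shows "\<exists>L. L-lipschitz_on UNIV (optimal_forward c u)"
proof -
  let ?F = "optimal_forward c u"
  obtain R where R: "reach \<bar>c\<bar> R" using ex_reach by blast
  obtain K where K: "K \<ge> 0"
    "\<And>z1 z2 a1 a2. \<lbrakk>z1 \<le> z2; z2 \<le> z1 + 1; (u has_real_derivative a1) (at z1);
       (u has_real_derivative a2) (at z2)\<rbrakk> \<Longrightarrow> a2 - a1 \<le> K * (z2 - z1)"
    by (rule calibrated_semiconcave[OF u]) blast
  obtain K' where K': "K' \<ge> 0" "\<And>x y x' y'. \<lbrakk>\<bar>x - y\<bar> \<le> R; \<bar>x' - x\<bar> \<le> 1; \<bar>y' - y\<bar> \<le> 1\<rbrakk> \<Longrightarrow>
       \<bar>partial1 S (x', y') - partial1 S (x, y)\<bar> \<le> K' * (\<bar>x' - x\<bar> + \<bar>y' - y\<bar>)"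
    by (rule partials_lipschitz_on_strip[of R]) blast
  define L where "L = (K + K') / e"
  have L0: "L \<ge> 0" using K(1) K'(1) e_pos by (simp add: L_def)
  have contr: "w2 - w1 \<le> L * (z2 - z1)"
    if z1: "u w1 + s = u z1 + S_coh S c (z1, w1)" and z2: "u w2 + s = u z2 + S_coh S c (z2, w2)"
      and z: "z1 \<le> z2" "z2 \<le> z1 + 1" and w: "w1 \<le> w2" for w1 w2 z1 z2
  proof -
    have der: "(u has_real_derivative - partial1 S (z, w) - c) (at z)"
      if "u w + s = u z + S_coh S c (z, w)" for z w
      using calibrated_interior_derivative[OF u _ that] calibrated_predecessor[OF u] by metis
    have "(- partial1 S (z2, w2) - c) - (- partial1 S (z1, w1) - c) \<le> K * (z2 - z1)"
      by (rule K(2)[OF z der[OF z1] der[OF z2]])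
    moreover have "\<bar>z1 - w1\<bar> \<le> R"
      using forward_maximizer_near[OF R _ calibrated_circle_fun[OF u] predecessor_maximizer[OF u z1]]
      by (simp add: abs_minus_commute)
    then have "\<bar>partial1 S (z2, w1) - partial1 S (z1, w1)\<bar> \<le> K' * (\<bar>z2 - z1\<bar> + \<bar>w1 - w1\<bar>)"
      using z by (intro K'(2)) auto
    moreover have "partial1 S (z2, w2) \<le> partial1 S (z2, w1) - e * (w2 - w1)"
      by (rule partial1_decreasing[OF w])
    ultimately have "e * (w2 - w1) \<le> (K + K') * (z2 - z1)"
      using z by (simp add: algebra_simps)
    then show ?thesis using e_pos by (simp add: L_def field_simps)
  qed
  have loc: "?F x2 - ?F x1 \<le> L * (x2 - x1)" if x: "x1 \<le> x2" "x2 \<le> x1 + 1" for x1 x2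
  proof (rule ccontr)
    assume neg: "\<not> ?thesis"
    define h where "h = (?F x2 - ?F x1 - L * (x2 - x1)) / 4"
    have h: "h > 0" using neg by (simp add: h_def)
    have "L * (x2 - x1) \<ge> 0" using x L0 by simp
    \<comment> \<open>The values \<open>?F x1\<close> and \<open>?F x2\<close> may have predecessors outside \<open>[x1, x2]\<close> if \<open>?F\<close> is locally
      constant; moving inwards by \<open>h\<close> forces the predecessors between \<open>x1\<close> and \<open>x2\<close>.\<close>
    define w1 w2 where "w1 = ?F x1 + h" and "w2 = ?F x2 - h"
    have w: "w1 \<le> w2" "w2 - w1 > L * (x2 - x1)"
      using h \<open>L * (x2 - x1) \<ge> 0\<close> by (auto simp: w1_def w2_def h_def field_simps)
    obtain z1 where z1: "u w1 + s = u z1 + S_coh S c (z1, w1)" using calibrated_predecessor[OF u] by blast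
    obtain z2 where z2: "u w2 + s = u z2 + S_coh S c (z2, w2)" using calibrated_predecessor[OF u] by blast
    have F: "?F z1 = w1" "?F z2 = w2" using optimal_forward_of_predecessor[OF u] z1 z2 by auto
    have less: "a < b" if "?F a < ?F b" for a b
      using monoD[OF optimal_forward_mono[OF u], of b a] that by (meson not_le)
    have "w1 < w2" using w \<open>L * (x2 - x1) \<ge> 0\<close> by linarith
    then have zz: "z1 < z2" "x1 < z1" "z2 < x2"
      using less h F by (auto simp: w1_def w2_def)
    then have "w2 - w1 \<le> L * (z2 - z1)" using x w by (intro contr[OF z1 z2]) auto
    also have "\<dots> \<le> L * (x2 - x1)" using zz L0 by (intro mult_left_mono) auto
    finally show False using w by simp
  qed
  have mono: "?F x1 \<le> ?F x2" if "x1 \<le> x2" for x1 x2 using monoD[OF optimal_forward_mono[OF u] that] .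
  have "\<bar>(?F x - x) - (?F y - y)\<bar> \<le> (L + 1) * \<bar>x - y\<bar>" if "\<bar>x - y\<bar> \<le> 1" for x y
    using loc[of x y] loc[of y x] mono[of x y] mono[of y x] that
    by (cases "x \<le> y") (auto simp: abs_le_iff algebra_simps)
  \<comment> \<open>The displacement is periodic, so the local estimate becomes global.\<close>
  from periodic_locally_lipschitz[of "\<lambda>x. ?F x - x", OF _ _ this]
  have glob: "\<bar>(?F x - x) - (?F y - y)\<bar> \<le> (L + 1) * \<bar>x - y\<bar>" for x y
    using optimal_forward_translate[OF u] L0 by simp
  have "(L + 2)-lipschitz_on UNIV ?F"
  proof (rule lipschitz_onI)
    fix x y
    have "\<bar>?F x - ?F y\<bar> \<le> \<bar>(?F x - x) - (?F y - y)\<bar> + \<bar>x - y\<bar>" by linarith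
    also have "\<dots> \<le> (L + 1) * \<bar>x - y\<bar> + \<bar>x - y\<bar>" using glob[of x y] by simp
    finally show "dist (?F x) (?F y) \<le> (L + 2) * dist x y"
      by (simp add: dist_real_def algebra_simps)
  qed (use L0 in simp)
  then show ?thesis by blast
qed

text \<open>The derivative of \<open>u\<close> at \<open>y = optimal_forward c u x\<close> equals \<open>partial2 S (\<cdot>, y) - c\<close> both at the
  predecessor of \<open>y\<close> and at \<open>x\<close>. By strict monotonicity \<open>x\<close> is this predecessor, hence a point where
  \<open>u\<close> is touched smoothly from both sides.\<close>

lemma optimal_forward_propagates_singularities:
  assumes u: "calibrated c s u" and diff: "u differentiable (at (optimal_forward c u x))"
  shows "u differentiable (at x)"
proof -
  let ?y = "optimal_forward c u x"
  obtain a where a: "(u has_real_derivative a) (at ?y)"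
    using diff by (auto simp: real_differentiable_def)
  obtain z where z: "u ?y + s = u z + S_coh S c (z, ?y)" using calibrated_predecessor[OF u] by blast
  have "a = partial2 S (z, ?y) - c" by (rule calibrated_derivative_from_predecessor[OF u z a])
  moreover have "a = partial2 S (x, ?y) - c"
  proof (rule derivative_eq_if_touching[OF a])
    show "((\<lambda>t. u ?y - S_coh S c (x, ?y) + S_coh S c (x, t)) has_real_derivative partial2 S (x, ?y) - c) (at ?y)"
      by (auto intro!: derivative_eq_intros DERIV_S_coh2)
    have "?y \<in> forward_maximizers S c u x" using forward_maximizers_eq[OF u] by simp
    then show "u t \<le> u ?y - S_coh S c (x, ?y) + S_coh S c (x, t)" for t
      unfolding forward_maximizers_iff by (simp add: algebra_simps)
  qed simp
  ultimately have eq: "partial2 S (z, ?y) = partial2 S (x, ?y)" by simp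
  have inj: "b \<le> a" if "partial2 S (a, t) = partial2 S (b, t)" for a b t
  proof (rule ccontr)
    assume "\<not> b \<le> a"
    then have "e * (b - a) > 0" using e_pos by simp
    then show False using partial2_decreasing[of a b t] that \<open>\<not> b \<le> a\<close> by simp
  qed
  have "z = x" using inj[OF eq] inj[OF eq[symmetric]] by simp
  then have z': "u ?y + s = u x + S_coh S c (x, ?y)" using z by simp
  obtain v where v: "u x + s = u v + S_coh S c (v, x)" using calibrated_predecessor[OF u] by blast
  show ?thesis
    using calibrated_interior_derivative[OF u v z'] by (auto simp: real_differentiable_def)
qed

section \<open>The rotation number and the derivative of Mather's function\<close>

lemma optimal_forward_rotates:
  assumes "calibrated c s u"
  shows "\<exists>\<rho>. rotates (optimal_forward c u) \<rho>"
  using degree_one_rotates optimal_forward_mono[OF assms] optimal_forward_translate[OF assms] by blast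

text \<open>Where the smaller solution equals the larger one, a predecessor for the larger one is also a
  predecessor for the smaller one and equality persists there. The two maps thus share backward
  orbits of any length.\<close>

lemma rotation_eq_if_touching:
  assumes u: "calibrated c s u" and v: "calibrated c s v" and le: "\<And>x. v x \<le> u x" and a: "v a = u a"
    and rot: "rotates (optimal_forward c u) \<rho>" "rotates (optimal_forward c v) \<sigma>"
  shows "\<rho> = \<sigma>"
proof -
  let ?U = "optimal_forward c u" and ?V = "optimal_forward c v"
  have orbit: "\<exists>x. (?U ^^ n) x = a \<and> (?V ^^ n) x = a \<and> v x = u x" for n
  proof (induction n)
    case 0
    then show ?case using a by auto
  next
    case (Suc n)
    then obtain x where x: "(?U ^^ n) x = a" "(?V ^^ n) x = a" "v x = u x" by blast
    obtain y where y: "u x + s = u y + S_coh S c (y, x)" using calibrated_predecessor[OF u] by blast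
    have "v y = u y"
      using calibrated_le[OF v, of x y] le[of y] y x(3) by simp
    then have "v x + s = v y + S_coh S c (y, x)" using y x(3) by simp
    then have "?U y = x" "?V y = x"
      using optimal_forward_of_predecessor u v y by blast+
    then show ?case
      using x \<open>v y = u y\<close> by (intro exI[of _ y]) (auto simp: funpow_Suc_right simp del: funpow.simps)
  qed
  have "\<bar>real n * \<rho> - real n * \<sigma>\<bar> \<le> 4" for n
  proof -
    obtain x where "(?U ^^ n) x = a" "(?V ^^ n) x = a" using orbit by blast
    moreover have "\<bar>(?U ^^ n) x - x - real n * \<rho>\<bar> \<le> 2" "\<bar>(?V ^^ n) x - x - real n * \<sigma>\<bar> \<le> 2"
      using rot unfolding rotates_def by blast+
    ultimately show ?thesis by linarith
  qed
  then have "real n * (\<rho> - \<sigma>) \<le> 4" "real n * (\<sigma> - \<rho>) \<le> 4" for n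
    by (auto simp: algebra_simps abs_le_iff)
  from zero_if_multiples_bounded[OF this(1)] zero_if_multiples_bounded[OF this(2)] show ?thesis by simp
qed

lemma calibrated_add_const:
  assumes "calibrated c s u"
  shows "calibrated c s (\<lambda>x. u x + k)"
  using assms unfolding calibrated_def circle_fun_def
  by (auto intro!: continuous_intros simp: algebra_simps)

lemma calibrated_min:
  assumes u: "calibrated c s u" and v: "calibrated c s v"
  shows "calibrated c s (\<lambda>x. min (u x) (v x))"
  unfolding calibrated_def
proof (intro conjI allI)
  show "circle_fun (\<lambda>x. min (u x) (v x))"
    using calibrated_circle_fun[OF u] calibrated_circle_fun[OF v]
    by (auto simp: circle_fun_def intro!: continuous_intros)
  show "min (u x) (v x) + s \<le> min (u y) (v y) + S_coh S c (y, x)" for x y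
    using calibrated_le[OF u, of x y] calibrated_le[OF v, of x y] by (auto simp: min_def)
  then have le: "min (u x) (v x) + s \<le> min (u y) (v y) + S_coh S c (y, x)" for x y .
  show "\<exists>y. min (u x) (v x) + s = min (u y) (v y) + S_coh S c (y, x)" for x
  proof (cases "u x \<le> v x")
    case True
    obtain y where "u x + s = u y + S_coh S c (y, x)" using calibrated_predecessor[OF u] by blast
    then show ?thesis using le[of x y] True by (intro exI[of _ y]) (auto simp: min_def split: if_splits)
  next
    case False
    obtain y where "v x + s = v y + S_coh S c (y, x)" using calibrated_predecessor[OF v] by blast
    then show ?thesis using le[of x y] False by (intro exI[of _ y]) (auto simp: min_def split: if_splits)
  qed
qed

lemma optimal_forward_add_const:
  "optimal_forward c (\<lambda>x. u x + k) = optimal_forward c u"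
  by (simp add: optimal_forward_def forward_maximizers_iff fun_eq_iff)

text \<open>The minimum of \<open>u\<close> and a translate of \<open>v\<close> that agrees with \<open>u\<close> at \<open>0\<close> touches both of them.\<close>

lemma rotation_independent:
  assumes u: "calibrated c s u" and v: "calibrated c s v"
    and rot: "rotates (optimal_forward c u) \<rho>" "rotates (optimal_forward c v) \<sigma>"
  shows "\<rho> = \<sigma>"
proof -
  define v' where "v' x = v x + (u 0 - v 0)" for x
  have v': "calibrated c s v'" unfolding v'_def by (rule calibrated_add_const[OF v])
  have rot': "rotates (optimal_forward c v') \<sigma>"
    using rot(2) by (simp add: v'_def[abs_def] optimal_forward_add_const)
  let ?m = "\<lambda>x. min (u x) (v' x)"
  have m: "calibrated c s ?m" by (rule calibrated_min[OF u v'])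
  then obtain \<tau> where \<tau>: "rotates (optimal_forward c ?m) \<tau>" using optimal_forward_rotates by blast
  have "\<rho> = \<tau>" by (rule rotation_eq_if_touching[OF u m _ _ rot(1) \<tau>, of 0]) (auto simp: v'_def)
  moreover have "\<sigma> = \<tau>" by (rule rotation_eq_if_touching[OF v' m _ _ rot' \<tau>, of 0]) (auto simp: v'_def)
  ultimately show ?thesis by simp
qed

text \<open>Along a backward orbit of predecessors of \<open>0\<close> of length \<open>n\<close> starting at \<open>x\<close>, let \<open>A\<close> be the total
  action \<open>S\<close>. The calibration of \<open>u\<close> gives an equality for \<open>A\<close>, the inequality for \<open>v\<close> an
  estimate, and the linear terms telescope to \<open>c * x\<close> and \<open>c' * x\<close>, where \<open>x\<close> is within \<open>2\<close> of \<open>- n \<rho>\<close>.\<close>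

lemma rotation_subgradient:
  assumes u: "calibrated c s u" and v: "calibrated c' s' v" and rot: "rotates (optimal_forward c u) \<rho>"
  shows "s' \<le> s - \<rho> * (c' - c)"
proof -
  let ?F = "optimal_forward c u"
  have orbit: "\<exists>x A. (?F ^^ n) x = 0 \<and> u 0 + real n * s = u x + A + c * x
      \<and> v 0 + real n * s' \<le> v x + A + c' * x" for n
  proof (induction n)
    case 0
    show ?case by (intro exI[of _ 0]) auto
  next
    case (Suc n)
    then obtain x A where x: "(?F ^^ n) x = 0" "u 0 + real n * s = u x + A + c * x"
      "v 0 + real n * s' \<le> v x + A + c' * x" by blast
    obtain y where y: "u x + s = u y + S_coh S c (y, x)" using calibrated_predecessor[OF u] by blast
    have "?F y = x" by (rule optimal_forward_of_predecessor[OF u y])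
    then have "(?F ^^ Suc n) y = 0" using x by (simp add: funpow_Suc_right del: funpow.simps)
    moreover have "u 0 + real (Suc n) * s = u y + (A + S (y, x)) + c * y"
      using x(2) y by (simp add: S_coh_eq algebra_simps)
    moreover have "v 0 + real (Suc n) * s' \<le> v y + (A + S (y, x)) + c' * y"
      using x(3) calibrated_le[OF v, of x y] by (simp add: S_coh_eq algebra_simps)
    ultimately show ?case by blast
  qed
  obtain B where B: "\<And>x. \<bar>u x\<bar> \<le> B" using circle_fun_bounded[OF calibrated_circle_fun[OF u]] by blast
  obtain B' where B': "\<And>x. \<bar>v x\<bar> \<le> B'" using circle_fun_bounded[OF calibrated_circle_fun[OF v]] by blast
  have "real n * (s' - s + \<rho> * (c' - c)) \<le> 2 * B + 2 * B' + \<bar>c' - c\<bar> * 2" for n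
  proof -
    obtain x A where x: "(?F ^^ n) x = 0" "u 0 + real n * s = u x + A + c * x"
      "v 0 + real n * s' \<le> v x + A + c' * x" using orbit by blast
    have "\<bar>0 - x - real n * \<rho>\<bar> \<le> 2" using rot x(1) unfolding rotates_def by metis
    then have "\<bar>c' - c\<bar> * \<bar>x + real n * \<rho>\<bar> \<le> \<bar>c' - c\<bar> * 2" by (intro mult_left_mono) auto
    then have "(c' - c) * (x + real n * \<rho>) \<le> \<bar>c' - c\<bar> * 2" by (simp add: abs_mult[symmetric] abs_le_iff)
    moreover have "real n * s' - real n * s \<le> (v x - v 0) + (u 0 - u x) + (c' - c) * x"
      using x(2,3) by (simp add: algebra_simps)
    moreover have "(v x - v 0) + (u 0 - u x) \<le> 2 * B + 2 * B'"
      using B[of 0] B[of x] B'[of 0] B'[of x] by (simp add: abs_le_iff)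
    ultimately show ?thesis by (simp add: algebra_simps)
  qed
  from zero_if_multiples_bounded[OF this] show ?thesis by simp
qed

text \<open>Limits of maximizers are maximizers, and the maximizer in the limit is unique; as all maximizers
  stay in a bounded region, the whole sequence converges.\<close>

lemma optimal_forward_limit:
  assumes cs: "cs \<longlonglongrightarrow> c" and us: "\<And>n. calibrated (cs n) (ss n) (us n)" and u: "calibrated c s u"
    and lim: "uniform_limit UNIV us u sequentially" and xs: "xs \<longlonglongrightarrow> x"
  shows "(\<lambda>n. optimal_forward (cs n) (us n) (xs n)) \<longlonglongrightarrow> optimal_forward c u x"
proof (rule ccontr)
  define y where "y n = optimal_forward (cs n) (us n) (xs n)" for n
  assume "\<not> ?thesis"
  then obtain r where r: "r > 0" "\<And>N. \<exists>n\<ge>N. \<not> dist (y n) (optimal_forward c u x) < r"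
    unfolding lim_sequentially y_def by blast
  define I where "I = {n. \<not> dist (y n) (optimal_forward c u x) < r}"
  have "infinite I" using r(2) unfolding infinite_nat_iff_unbounded_le I_def by blast
  define k where "k = enumerate I"
  have k: "strict_mono k" "k n \<in> I" for n
    unfolding k_def using \<open>infinite I\<close> by (auto simp: strict_mono_enumerate enumerate_in_set)
  obtain C where C: "\<And>n. \<bar>cs n\<bar> \<le> C"
    using convergent_imp_Bseq[of cs] cs by (auto simp: convergent_def Bseq_def)
  obtain X where X: "\<And>n. \<bar>xs n\<bar> \<le> X"
    using convergent_imp_Bseq[of xs] xs by (auto simp: convergent_def Bseq_def)
  obtain R where R: "reach C R" using ex_reach by blast
  have opt: "y n \<in> forward_maximizers S (cs n) (us n) (xs n)" for n
    unfolding y_def using forward_maximizers_eq[OF us] by blast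
  have y_bounded: "\<bar>y n\<bar> \<le> X + R" for n
    using forward_maximizer_near[OF R C calibrated_circle_fun[OF us] opt, of n] X[of n] by linarith
  have "y (k n) \<in> {-(X + R)..X + R}" for n
    using y_bounded[of "k n"] by (simp add: abs_le_iff)
  then obtain z j where j: "strict_mono (j :: nat \<Rightarrow> nat)" and z: "((\<lambda>n. y (k n)) \<circ> j) \<longlonglongrightarrow> z"
    using compact_imp_seq_compact[OF compact_Icc] unfolding seq_compact_def by metis
  define m where "m n = k (j n)" for n
  have m: "strict_mono m" using k(1) j by (simp add: m_def strict_mono_def)
  have yz: "(\<lambda>n. y (m n)) \<longlonglongrightarrow> z" using z by (simp add: o_def m_def)
  have ul: "uniform_limit UNIV (\<lambda>n. us (m n)) u sequentially"
    using lim m by (auto simp: uniform_limit_iff dest: eventually_subseq)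
  have cm: "(\<lambda>n. cs (m n)) \<longlonglongrightarrow> c" using LIMSEQ_subseq_LIMSEQ[OF cs m] by (simp add: o_def)
  have xm: "(\<lambda>n. xs (m n)) \<longlonglongrightarrow> x" using LIMSEQ_subseq_LIMSEQ[OF xs m] by (simp add: o_def)
  have act: "(\<lambda>n. S_coh S (cs (m n)) (xs (m n), t n)) \<longlonglongrightarrow> S_coh S c (x, t')" if "t \<longlonglongrightarrow> t'" for t t'
  proof -
    have "isCont S (x, t')" using continuous_S[of UNIV] by (simp add: continuous_on_eq_continuous_at)
    moreover have "(\<lambda>n. (xs (m n), t n)) \<longlonglongrightarrow> (x, t')" using xm that by (rule tendsto_Pair)
    ultimately have "(\<lambda>n. S (xs (m n), t n)) \<longlonglongrightarrow> S (x, t')" by (rule isCont_tendsto_compose)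
    then show ?thesis unfolding S_coh_eq by (intro tendsto_intros cm xm that)
  qed
  have "isCont u z"
    using calibrated_circle_fun[OF u] by (simp add: circle_fun_def continuous_on_eq_continuous_at)
  then have "(\<lambda>n. u (y (m n))) \<longlonglongrightarrow> u z" using yz by (rule isCont_tendsto_compose)
  moreover have "(\<lambda>n. us (m n) (y (m n)) - u (y (m n))) \<longlonglongrightarrow> 0"
  proof (rule tendstoI)
    fix \<epsilon> :: real assume "\<epsilon> > 0"
    from uniform_limitD[OF ul this]
    show "\<forall>\<^sub>F n in sequentially. dist (us (m n) (y (m n)) - u (y (m n))) 0 < \<epsilon>"
      by eventually_elim (simp add: dist_real_def)
  qed
  ultimately have uy: "(\<lambda>n. us (m n) (y (m n))) \<longlonglongrightarrow> u z"
    using tendsto_add by fastforce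
  have "u t - S_coh S c (x, t) \<le> u z - S_coh S c (x, z)" for t
  proof (rule LIMSEQ_le)
    show "(\<lambda>n. us (m n) t - S_coh S (cs (m n)) (xs (m n), t)) \<longlonglongrightarrow> u t - S_coh S c (x, t)"
      by (intro tendsto_diff act tendsto_const tendsto_uniform_limitI[OF ul]) simp
    show "(\<lambda>n. us (m n) (y (m n)) - S_coh S (cs (m n)) (xs (m n), y (m n))) \<longlonglongrightarrow> u z - S_coh S c (x, z)"
      by (intro tendsto_diff act uy yz)
    show "\<exists>N. \<forall>n\<ge>N. us (m n) t - S_coh S (cs (m n)) (xs (m n), t)
        \<le> us (m n) (y (m n)) - S_coh S (cs (m n)) (xs (m n), y (m n))"
      using opt unfolding forward_maximizers_iff by blast
  qed
  then have "optimal_forward c u x = z"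
    by (intro optimal_forward_eqI[OF u]) (simp add: forward_maximizers_iff)
  moreover have "r \<le> dist (y (m n)) (optimal_forward c u x)" for n
    using k(2)[of "j n"] by (simp add: I_def m_def)
  ultimately have "\<And>n. r \<le> dist (y (m n)) z" by simp
  moreover obtain n where "dist (y (m n)) z < r"
    using tendstoD[OF yz r(1)] by (auto simp: eventually_sequentially)
  ultimately show False by (meson not_le)
qed

text \<open>Otherwise there are \<open>c\<^sub>n \<rightarrow> c\<close> with rotation numbers at distance at least \<open>r\<close> from that at \<open>c\<close>. A
  subsequence of normalized solutions converges to a solution at \<open>c\<close>. For a fixed \<open>N\<close> with \<open>N * r > 5\<close>
  the \<open>N\<close>-th iterates then converge, which is impossible since each of them determines its
  rotation number up to \<open>2 / N\<close>.\<close>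

lemma rotation_continuous:
  assumes \<rho>: "\<And>c u. calibrated c (S_bar S c) u \<Longrightarrow> rotates (optimal_forward c u) (\<rho> c)"
  shows "isCont \<rho> c"
proof (rule ccontr)
  assume "\<not> isCont \<rho> c"
  then obtain r where r: "r > 0" "\<And>d. d > 0 \<Longrightarrow> \<exists>c'. dist c' c < d \<and> \<not> dist (\<rho> c') (\<rho> c) < r"
    unfolding continuous_at_eps_delta by (auto simp: dist_commute)
  have "\<forall>n. \<exists>c'. dist c' c < inverse (real (Suc n)) \<and> \<not> dist (\<rho> c') (\<rho> c) < r"
    using r(2) by simp
  then obtain cs where cs: "\<And>n. dist (cs n) c < inverse (real (Suc n))" "\<And>n. \<not> dist (\<rho> (cs n)) (\<rho> c) < r"
    by metis
  have cs_lim: "cs \<longlonglongrightarrow> c"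
    unfolding tendsto_dist_iff[of cs] using cs(1)
    by (intro Lim_null_comparison[OF _ LIMSEQ_inverse_real_of_nat]) (auto simp: less_imp_le)
  have "\<exists>u. calibrated (cs n) (S_bar S (cs n)) u \<and> u 0 = 0" for n
  proof -
    obtain u where "calibrated (cs n) (S_bar S (cs n)) u" using calibrated_S_bar by blast
    from calibrated_add_const[OF this, of "- u 0"] show ?thesis by auto
  qed
  then obtain us where us: "\<And>n. calibrated (cs n) (S_bar S (cs n)) (us n)" "\<And>n. us n 0 = 0" by metis
  obtain C where C: "\<And>n. \<bar>cs n\<bar> \<le> C"
    using convergent_imp_Bseq[of cs] cs_lim by (auto simp: convergent_def Bseq_def)
  obtain L where L: "\<forall>c u x y. \<bar>c\<bar> \<le> C \<longrightarrow> circle_fun u \<longrightarrow>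
      \<bar>T_minus S c u x - T_minus S c u y\<bar> \<le> L * \<bar>x - y\<bar>"
    using T_minus_lipschitz[of C] ..
  have usf: "circle_fun (us n)" for n using us(1) calibrated_circle_fun by blast
  have lip: "\<bar>us n x - us n y\<bar> \<le> L * \<bar>x - y\<bar>" for n x y
    using L[rule_format, OF C[of n] usf[of n], of x y] calibrated_T_minus[OF us(1)] by simp
  obtain u k where k: "strict_mono (k :: nat \<Rightarrow> nat)" "uniform_limit UNIV (\<lambda>n. us (k n)) u sequentially"
    and u: "continuous_on UNIV u" "\<And>x. u (x + 1) = u x"
    by (rule periodic_Arzela_Ascoli[of us L 0]) (use usf lip us(2) in \<open>auto simp: circle_fun_def\<close>)
  have uf: "circle_fun u" using u by (simp add: circle_fun_def)
  have ck: "(\<lambda>n. cs (k n)) \<longlonglongrightarrow> c" using LIMSEQ_subseq_LIMSEQ[OF cs_lim k(1)] by (simp add: o_def)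
  have uk: "(\<lambda>n. us (k n) x) \<longlonglongrightarrow> u x" for x using tendsto_uniform_limitI[OF k(2)] by simp
  have Tk: "(\<lambda>n. us (k n) x + S_bar S (cs (k n))) \<longlonglongrightarrow> T_minus S c u x" for x
    using T_minus_uniform_limit[OF ck usf uf k(2), of x] calibrated_T_minus[OF us(1)] by simp
  have sk: "(\<lambda>n. S_bar S (cs (k n))) \<longlonglongrightarrow> T_minus S c u x - u x" for x
    using tendsto_diff[OF Tk[of x] uk[of x]] by simp
  have "T_minus S c u x = u x + (T_minus S c u 0 - u 0)" for x
    using LIMSEQ_unique[OF sk[of x] sk[of 0]] by simp
  then have cal0: "calibrated c (T_minus S c u 0 - u 0) u" by (rule calibratedI[OF uf])
  then have cal: "calibrated c (S_bar S c) u" using S_bar_eq by simp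
  have orb: "(\<lambda>n. (optimal_forward (cs (k n)) (us (k n)) ^^ N) 0) \<longlonglongrightarrow> (optimal_forward c u ^^ N) 0" for N
  proof (induction N)
    case (Suc N)
    show ?case
      using optimal_forward_limit[OF ck us(1) cal k(2) Suc] by simp
  qed simp
  obtain N :: nat where N: "5 < real N * r" using ex_less_of_nat_mult[OF r(1)] by blast
  have "\<forall>\<^sub>F n in sequentially. dist ((optimal_forward (cs (k n)) (us (k n)) ^^ N) 0) ((optimal_forward c u ^^ N) 0) < 1"
    by (rule tendstoD[OF orb]) simp
  then obtain n where n: "dist ((optimal_forward (cs (k n)) (us (k n)) ^^ N) 0) ((optimal_forward c u ^^ N) 0) < 1"
    by (auto simp: eventually_sequentially)
  have "\<bar>(optimal_forward (cs (k n)) (us (k n)) ^^ N) 0 - 0 - real N * \<rho> (cs (k n))\<bar> \<le> 2"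
    using \<rho>[OF us(1)] unfolding rotates_def by blast
  moreover have "\<bar>(optimal_forward c u ^^ N) 0 - 0 - real N * \<rho> c\<bar> \<le> 2"
    using \<rho>[OF cal] unfolding rotates_def by blast
  ultimately have "\<bar>real N * \<rho> (cs (k n)) - real N * \<rho> c\<bar> \<le> 5"
    using n unfolding dist_real_def by linarith
  then have "real N * dist (\<rho> (cs (k n))) (\<rho> c) \<le> 5"
    by (simp add: dist_real_def abs_mult right_diff_distrib[symmetric])
  moreover have "real N * r \<le> real N * dist (\<rho> (cs (k n))) (\<rho> c)"
    using cs(2)[of "k n"] by (intro mult_left_mono) auto
  ultimately show False using N by simp
qed

lemma mather_alpha_derivative:
  assumes u: "calibrated c (S_bar S c) u" and rot: "rotates (optimal_forward c u) r"
  shows "(mather_alpha S has_real_derivative r) (at c)"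
proof -
  have "\<exists>\<rho>. \<forall>u. calibrated c (S_bar S c) u \<longrightarrow> rotates (optimal_forward c u) \<rho>" for c
  proof -
    obtain u where u: "calibrated c (S_bar S c) u" using calibrated_S_bar by blast
    obtain \<rho> where "rotates (optimal_forward c u) \<rho>" using optimal_forward_rotates[OF u] by blast
    then show ?thesis using rotation_independent[OF u] optimal_forward_rotates by metis
  qed
  then obtain \<rho> where \<rho>: "\<And>c u. calibrated c (S_bar S c) u \<Longrightarrow> rotates (optimal_forward c u) (\<rho> c)"
    by metis
  have "(mather_alpha S has_real_derivative \<rho> c) (at c)"
  proof (rule has_derivative_if_continuous_subgradient)
    fix x y
    obtain u v where "calibrated x (S_bar S x) u" "calibrated y (S_bar S y) v"
      using calibrated_S_bar by blast
    then have "S_bar S y \<le> S_bar S x - \<rho> x * (y - x)" by (intro rotation_subgradient \<rho>)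
    then show "mather_alpha S y \<ge> mather_alpha S x + \<rho> x * (y - x)" by (simp add: mather_alpha_def)
  qed (rule rotation_continuous[OF \<rho>])
  then show ?thesis using rotation_independent[OF u u rot \<rho>[OF u]] by simp
qed

end

theorem theorem1p1:
  fixes f :: "annulus \<Rightarrow> annulus"
    and F :: "real \<times> real \<Rightarrow> real \<times> real"
    and S :: "real \<times> real \<Rightarrow> real"
    and c :: real
    and u :: "real \<Rightarrow> real"
  assumes "twist_map f"
    and "is_lift f F"
    and "generating_function F S"
    and "weak_KAM_solution S c u"
  shows "\<exists>\<Sigma> :: real \<Rightarrow> real.
    (\<forall>x. forward_maximizers S c u x = {\<Sigma> x}) \<and>
    (\<forall>x. \<Sigma> (x + 1) = \<Sigma> x + 1) \<and>
    mono \<Sigma> \<and> (\<exists>L. L-lipschitz_on UNIV \<Sigma>) \<and>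
    (\<forall>x. \<not> u differentiable (at x) \<longrightarrow> \<not> u differentiable (at (\<Sigma> x))) \<and>
    (\<exists>\<rho>. (\<forall>x. (\<lambda>n. ((\<Sigma> ^^ n) x - x) / real n) \<longlonglongrightarrow> \<rho>) \<and>
         (mather_alpha S has_real_derivative \<rho>) (at c))"
proof -
  obtain e where "e > 0" "\<And>z. partial1 (partial2 S) z < - e"
    using assms(3) unfolding generating_function_def by blast
  then interpret twist_generating S e
    using assms(3) by unfold_locales (auto simp: generating_function_def)
  have u: "calibrated c (S_bar S c) u"
    using assms(4) by (simp add: weak_KAM_solution_def weak_KAM_eq_iff_calibrated)
  obtain \<rho> where \<rho>: "rotates (optimal_forward c u) \<rho>" using optimal_forward_rotates[OF u] by blast
  show ?thesis
  proof (intro exI[of _ "optimal_forward c u"] conjI allI impI)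
    show "\<exists>\<rho>. (\<forall>x. (\<lambda>n. ((optimal_forward c u ^^ n) x - x) / real n) \<longlonglongrightarrow> \<rho>) \<and>
         (mather_alpha S has_real_derivative \<rho>) (at c)"
      using rotates_tendsto[OF \<rho>] mather_alpha_derivative[OF u \<rho>] by blast
  qed (use forward_maximizers_eq[OF u] optimal_forward_translate[OF u] optimal_forward_mono[OF u]
      optimal_forward_lipschitz[OF u] optimal_forward_propagates_singularities[OF u] in blast)+
qed

end
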